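(* Let $A$ be a complete Heyting algebra with a well-founded basis $K$ and let $\mathcal{C}$ be a $\mathrm{Sh}(A)$-enriched category whose externalisation is complete (in the ordinary sense). Then $\mathcal{C}$ is contractively complete: every locally contractive enriched functor $F:\mathcal{C}\to\mathcal{C}$ has an object $X$ with $FX\cong X$ (isomorphism in the externalisation of $\mathcal{C}$).
   Context: A basis $K\subseteq A$: every $a\in A$ is the join of $\{k\in K\mid k\le a\}$; well-founded: no infinite strictly descending sequence in $K$. $\mathrm{Sh}(A)$: presheaves $X$ on $A$ such that $(X(\bigvee B)\to X(b))_{b\in B}$ is a limit cone for all $B\subseteq A$. Predecessor: $p(a)=\bigvee\{k\in K\mid k<a\}$. Later functor on $\mathrm{Sh}(A)$: $\blacktriangleright X=\mathbf{a}(X\circ p)$ with $\mathbf{a}$ the associated sheaf functor; $\mathrm{next}_X=\mathbf{a}(\mathrm{next}^{pre}_X)$, $\mathrm{next}^{pre}_a(x)=x|_{p(a)}$. The externalisation of an enriched category $\mathcal{C}$ has the same objects and as morphisms $X\to Y$ the global elements $1\to\mathrm{Hom}_{\mathcal{C}}(X,Y)$. For $\mathcal{C}$ enriched, ${}_{\blacktriangleright}\mathcal{C}$ is the enriched category with the same objects, hom-objects $\blacktriangleright\mathrm{Hom}_{\mathcal{C}}(X,Y)$, composition $\blacktriangleright(\mathrm{comp})$ precomposed with the canonical iso $\blacktriangleright A\times\blacktriangleright B\cong\blacktriangleright(A\times B)$, and identities $\mathrm{next}\circ\ulcorner\mathrm{id}\urcorner$; $\mathrm{next}$ gives an enriched functor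 $\mathcal{C}\to{}_{\blacktriangleright}\mathcal{C}$ that is the identity on objects. An enriched functor $F:\mathcal{D}\to\mathcal{C}$ is locally contractive if it factors as an enriched functor $\mathcal{D}\xrightarrow{\mathrm{next}}{}_{\blacktriangleright}\mathcal{D}\to\mathcal{C}$. *)

theory Defs
  imports Main
begin

unbundle cardinal_syntax

section \<open>Complete Heyting algebras and well-founded bases\<close>

text \<open>The library's \<open>complete_distrib_lattice\<close> is completely distributive, which is too strong.
  Here the Heyting implication \<open>a \<rightarrow> b\<close> is only required to exist; it is unique.\<close>

class complete_heyting_algebra = complete_lattice +
  assumes heyting: "\<exists>c. \<forall>x. inf x a \<le> b \<longleftrightarrow> x \<le> c"
begin

lemma inf_Sup_frame: "inf a (Sup B) = Sup (inf a ` B)"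
proof (rule order.antisym)
  obtain c where c: "\<And>x. inf x a \<le> Sup (inf a ` B) \<longleftrightarrow> x \<le> c"
    using heyting by blast
  have "b \<le> c" if "b \<in> B" for b
    unfolding c[symmetric] using that by (auto intro!: Sup_upper simp: inf_commute)
  then have "inf (Sup B) a \<le> Sup (inf a ` B)"
    unfolding c by (rule Sup_least)
  then show "inf a (Sup B) \<le> Sup (inf a ` B)"
    by (simp add: inf_commute)
qed (auto intro!: Sup_least intro: Sup_upper le_infI2)

end

definition basis :: "'a::complete_heyting_algebra set \<Rightarrow> bool" where
  "basis K \<longleftrightarrow> (\<forall>a. a = Sup {k \<in> K. k \<le> a})"

definition well_founded_basis :: "'a::complete_heyting_algebra set \<Rightarrow> bool" where
  "well_founded_basis K \<longleftrightarrow>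
     basis K \<and> \<not> (\<exists>f :: nat \<Rightarrow> 'a. \<forall>n. f n \<in> K \<and> f (Suc n) < f n)"

definition predecessor :: "'a::complete_heyting_algebra set \<Rightarrow> 'a \<Rightarrow> 'a" where
  "predecessor K a = Sup {k \<in> K. k < a}"

section \<open>Presheaves and sheaves\<close>

text \<open>\<open>restr X a b\<close> is the restriction from stage \<open>a\<close> to a stage \<open>b \<le> a\<close>; it is
  irrelevant elsewhere. Likewise the components of a morphism matter only on sections.\<close>

record ('a, 's) psh =
  sections :: "'a \<Rightarrow> 's set"
  restr :: "'a \<Rightarrow> 'a \<Rightarrow> 's \<Rightarrow> 's"

definition presheaf :: "('a::complete_heyting_algebra, 's) psh \<Rightarrow> bool" where
  "presheaf X \<longleftrightarrow>
     (\<forall>a b x. b \<le> a \<and> x \<in> sections X a \<longrightarrow> restr X a b x \<in> sections X b) \<and>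
     (\<forall>a x. x \<in> sections X a \<longrightarrow> restr X a a x = x) \<and>
     (\<forall>a b c x. c \<le> b \<and> b \<le> a \<and> x \<in> sections X a \<longrightarrow>
        restr X b c (restr X a b x) = restr X a c x)"

definition psh_hom ::
  "('a::complete_heyting_algebra, 's) psh \<Rightarrow> ('a, 't) psh \<Rightarrow> ('a \<Rightarrow> 's \<Rightarrow> 't) \<Rightarrow> bool" where
  "psh_hom X Y f \<longleftrightarrow>
     (\<forall>a x. x \<in> sections X a \<longrightarrow> f a x \<in> sections Y a) \<and>
     (\<forall>a b x. b \<le> a \<and> x \<in> sections X a \<longrightarrow> f b (restr X a b x) = restr Y a b (f a x))"

text \<open>\<open>B\<close> need not be downward closed, so matching is imposed on the meets of its members.\<close>

definition matching :: "('a::complete_heyting_algebra, 's) psh \<Rightarrow> 'a set \<Rightarrow> ('a \<Rightarrow> 's) \<Rightarrow> bool" where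
  "matching X B x \<longleftrightarrow>
     (\<forall>b\<in>B. x b \<in> sections X b) \<and>
     (\<forall>b\<in>B. \<forall>c\<in>B. restr X b (inf b c) (x b) = restr X c (inf b c) (x c))"

definition sheaf :: "('a::complete_heyting_algebra, 's) psh \<Rightarrow> bool" where
  "sheaf X \<longleftrightarrow> presheaf X \<and>
     (\<forall>B x. matching X B x \<longrightarrow>
        (\<exists>!y. y \<in> sections X (Sup B) \<and> (\<forall>b\<in>B. restr X (Sup B) b y = x b)))"

definition one_psh :: "('a::complete_heyting_algebra, unit) psh" where
  "one_psh = \<lparr>sections = (\<lambda>a. UNIV), restr = (\<lambda>a b x. x)\<rparr>"

definition prod_psh ::
  "('a::complete_heyting_algebra, 's) psh \<Rightarrow> ('a, 't) psh \<Rightarrow> ('a, 's \<times> 't) psh" where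
  "prod_psh X Y =
     \<lparr>sections = (\<lambda>a. sections X a \<times> sections Y a),
      restr = (\<lambda>a b (x, y). (restr X a b x, restr Y a b y))\<rparr>"

section \<open>The associated sheaf\<close>

definition locally :: "'a::complete_heyting_algebra \<Rightarrow> ('a \<Rightarrow> bool) \<Rightarrow> bool" where
  "locally a Q \<longleftrightarrow> Sup {b. b \<le> a \<and> Q b} = a"

lemma locallyI:
  assumes "Q a" shows "locally a Q"
  unfolding locally_def using assms by (intro order.antisym Sup_least Sup_upper) auto

lemma locally_mono:
  assumes "locally a Q" "\<And>b. b \<le> a \<Longrightarrow> Q b \<Longrightarrow> R b" shows "locally a R"
proof -
  have "Sup {b. b \<le> a \<and> Q b} \<le> Sup {b. b \<le> a \<and> R b}"
    using assms(2) by (intro Sup_subset_mono) auto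
  moreover have "Sup {b. b \<le> a \<and> R b} \<le> a" by (auto intro: Sup_least)
  ultimately show ?thesis using assms(1) unfolding locally_def by (auto intro: order.antisym)
qed

lemma locally_cong:
  assumes "\<And>b. b \<le> a \<Longrightarrow> Q b \<longleftrightarrow> R b" shows "locally a Q \<longleftrightarrow> locally a R"
  using locally_mono[of a Q R] locally_mono[of a R Q] assms by blast

lemma locally_restrict:
  assumes "locally a Q" "b \<le> a" "\<And>c d. c \<le> a \<Longrightarrow> d \<le> c \<Longrightarrow> Q c \<Longrightarrow> Q d"
  shows "locally b Q"
proof -
  have "b = inf b (Sup {c. c \<le> a \<and> Q c})"
    using assms(1,2) by (simp add: locally_def inf_absorb1)
  also have "\<dots> = Sup (inf b ` {c. c \<le> a \<and> Q c})" by (rule inf_Sup_frame)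
  also have "\<dots> \<le> Sup {c. c \<le> b \<and> Q c}"
    using assms(3) by (intro Sup_subset_mono) auto
  finally show ?thesis unfolding locally_def by (auto intro!: order.antisym Sup_least)
qed

lemma locally_trans:
  assumes "locally a Q" "\<And>b. b \<le> a \<Longrightarrow> Q b \<Longrightarrow> locally b R" shows "locally a R"
proof -
  have "Sup {b. b \<le> a \<and> Q b} \<le> Sup {b. b \<le> a \<and> R b}"
  proof (rule Sup_least)
    fix b assume "b \<in> {b. b \<le> a \<and> Q b}"
    then have b: "b \<le> a" "locally b R" using assms(2) by auto
    have "b = Sup {c. c \<le> b \<and> R c}" using b(2) by (simp add: locally_def)
    also have "\<dots> \<le> Sup {b. b \<le> a \<and> R b}" using b(1) by (intro Sup_subset_mono) auto
    finally show "b \<le> Sup {b. b \<le> a \<and> R b}" .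
  qed
  then show ?thesis using assms(1) unfolding locally_def
    by (auto intro!: order.antisym Sup_least)
qed

lemma locally_conj:
  assumes "locally a Q" "locally a R"
    "\<And>c d. c \<le> a \<Longrightarrow> d \<le> c \<Longrightarrow> Q c \<Longrightarrow> Q d" "\<And>c d. c \<le> a \<Longrightarrow> d \<le> c \<Longrightarrow> R c \<Longrightarrow> R d"
  shows "locally a (\<lambda>b. Q b \<and> R b)"
proof (rule locally_trans[OF assms(1)])
  fix b assume b: "b \<le> a" "Q b"
  have "locally b R" using assms(2) b(1) assms(4) by (rule locally_restrict)
  then show "locally b (\<lambda>b. Q b \<and> R b)"
    by (rule locally_mono) (use assms(3) b in blast)
qed

lemma locally_Sup: "(\<And>b. b \<in> B \<Longrightarrow> locally b Q) \<Longrightarrow> locally (Sup B) Q"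
  by (rule locally_trans[where Q = "\<lambda>b. b \<in> B"])
     (auto simp: locally_def intro!: order.antisym Sup_least intro: Sup_upper)

text \<open>A section over \<open>a\<close> of the associated sheaf of \<open>P\<close> is a family of sections of \<open>P\<close>, defined
  on a cover of \<open>a\<close> and locally matching, up to local equality. Each equivalence class is
  represented by its largest member: the set \<open>G\<close> of all pairs \<open>(b, x)\<close> such that \<open>x \<in> P b\<close>
  agrees locally with the family. The universal property is proved below.\<close>

definition germs :: "('a::complete_heyting_algebra, 's) psh \<Rightarrow> 'a \<Rightarrow> ('a \<times> 's) set \<Rightarrow> bool" where
  "germs P a G \<longleftrightarrow>
     (\<forall>b x. (b, x) \<in> G \<longrightarrow> b \<le> a \<and> x \<in> sections P b) \<and>
     (\<forall>b c x. (b, x) \<in> G \<and> c \<le> b \<longrightarrow> (c, restr P b c x) \<in> G) \<and>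
     (\<forall>b x. b \<le> a \<and> x \<in> sections P b \<and> locally b (\<lambda>c. (c, restr P b c x) \<in> G)
        \<longrightarrow> (b, x) \<in> G) \<and>
     (\<forall>b x y. (b, x) \<in> G \<and> (b, y) \<in> G \<longrightarrow> locally b (\<lambda>c. restr P b c x = restr P b c y)) \<and>
     locally a (\<lambda>b. \<exists>x. (b, x) \<in> G)"

definition sheafify :: "('a::complete_heyting_algebra, 's) psh \<Rightarrow> ('a, ('a \<times> 's) set) psh" where
  "sheafify P =
     \<lparr>sections = (\<lambda>a. {G. germs P a G}),
      restr = (\<lambda>a b G. {(c, x). (c, x) \<in> G \<and> c \<le> b})\<rparr>"

definition sheafify_unit ::
  "('a::complete_heyting_algebra, 's) psh \<Rightarrow> 'a \<Rightarrow> 's \<Rightarrow> ('a \<times> 's) set" where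
  "sheafify_unit P a x =
     {(b, y). b \<le> a \<and> y \<in> sections P b \<and> locally b (\<lambda>c. restr P b c y = restr P a c x)}"

lemma presheaf_restr:
  assumes "presheaf P" "x \<in> sections P a"
  shows "b \<le> a \<Longrightarrow> restr P a b x \<in> sections P b"
    and "restr P a a x = x"
    and "c \<le> b \<Longrightarrow> b \<le> a \<Longrightarrow> restr P b c (restr P a b x) = restr P a c x"
  using assms unfolding presheaf_def by blast+

lemma sheaf_presheaf: "sheaf Y \<Longrightarrow> presheaf Y"
  by (simp add: sheaf_def)

lemma sheaf_separated:
  assumes Y: "sheaf Y" and y: "y \<in> sections Y a" "y' \<in> sections Y a"
    and loc: "locally a (\<lambda>b. restr Y a b y = restr Y a b y')"
  shows "y = y'"
proof -
  note P = presheaf_restr[OF sheaf_presheaf[OF Y]]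
  define B where "B = {b. b \<le> a \<and> restr Y a b y = restr Y a b y'}"
  have B: "Sup B = a" using loc by (simp add: B_def locally_def)
  have "matching Y B (\<lambda>b. restr Y a b y)"
    unfolding matching_def
  proof (intro conjI ballI)
    fix b c assume "b \<in> B" "c \<in> B"
    then have b: "b \<le> a" and c: "c \<le> a" by (simp_all add: B_def)
    show "restr Y a b y \<in> sections Y b" using P(1)[OF y(1) b] .
    show "restr Y b (inf b c) (restr Y a b y) = restr Y c (inf b c) (restr Y a c y)"
      using P(3)[OF y(1) inf_le1 b] P(3)[OF y(1) inf_le2 c] by metis
  qed
  then have "\<exists>!z. z \<in> sections Y (Sup B) \<and> (\<forall>b\<in>B. restr Y (Sup B) b z = restr Y a b y)"
    using Y by (simp add: sheaf_def)
  then have ex1: "\<exists>!z. z \<in> sections Y a \<and> (\<forall>b\<in>B. restr Y a b z = restr Y a b y)"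
    by (simp only: B)
  have "\<forall>b\<in>B. restr Y a b y' = restr Y a b y" by (simp add: B_def)
  then show ?thesis using ex1 y by blast
qed

lemma germsD:
  assumes "germs P a G"
  shows "(b, x) \<in> G \<Longrightarrow> b \<le> a"
    and "(b, x) \<in> G \<Longrightarrow> x \<in> sections P b"
    and "(b, x) \<in> G \<Longrightarrow> c \<le> b \<Longrightarrow> (c, restr P b c x) \<in> G"
    and "b \<le> a \<Longrightarrow> x \<in> sections P b \<Longrightarrow> locally b (\<lambda>c. (c, restr P b c x) \<in> G) \<Longrightarrow> (b, x) \<in> G"
    and "(b, x) \<in> G \<Longrightarrow> (b, y) \<in> G \<Longrightarrow> locally b (\<lambda>c. restr P b c x = restr P b c y)"
    and "locally a (\<lambda>b. \<exists>x. (b, x) \<in> G)"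
  using assms unfolding germs_def by blast+

lemma germs_restrict_cover:
  assumes "germs P a G" "b \<le> a"
  shows "locally b (\<lambda>c. \<exists>x. (c, x) \<in> G)"
  using germsD(6)[OF assms(1)] assms(2)
  by (rule locally_restrict) (use germsD(3)[OF assms(1)] in blast)

lemma germs_subset:
  assumes P: "presheaf P" and G: "germs P a G" and H: "germs P a H"
    and loc: "locally a (\<lambda>b. \<exists>x. (b, x) \<in> G \<and> (b, x) \<in> H)"
  shows "G \<subseteq> H"
proof (clarify)
  fix c y assume cy: "(c, y) \<in> G"
  note c = germsD(1,2)[OF G cy]
  have "locally c (\<lambda>b. \<exists>x. (b, x) \<in> G \<and> (b, x) \<in> H)"
    using loc c(1) by (rule locally_restrict) (use germsD(3)[OF G] germsD(3)[OF H] in blast)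
  then have "locally c (\<lambda>d. (d, restr P c d y) \<in> H)"
  proof (rule locally_trans)
    fix b assume b: "b \<le> c" "\<exists>x. (b, x) \<in> G \<and> (b, x) \<in> H"
    then obtain x where x: "(b, x) \<in> G" "(b, x) \<in> H" by blast
    have "locally b (\<lambda>d. restr P b d x = restr P b d (restr P c b y))"
      using germsD(5)[OF G x(1) germsD(3)[OF G cy b(1)]] .
    then show "locally b (\<lambda>d. (d, restr P c d y) \<in> H)"
    proof (rule locally_mono)
      fix d assume "d \<le> b" "restr P b d x = restr P b d (restr P c b y)"
      then show "(d, restr P c d y) \<in> H"
        using germsD(3)[OF H x(2), of d] presheaf_restr(3)[OF P c(2) _ b(1)] by simp
    qed
  qed
  then show "(c, y) \<in> H" using germsD(4)[OF H c] by blast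
qed

lemma germs_eqI:
  assumes "presheaf P" "germs P a G" "germs P a H"
    "locally a (\<lambda>b. \<exists>x. (b, x) \<in> G \<and> (b, x) \<in> H)"
  shows "G = H"
proof (rule subset_antisym)
  show "G \<subseteq> H" using assms by (rule germs_subset)
  have "locally a (\<lambda>b. \<exists>x. (b, x) \<in> H \<and> (b, x) \<in> G)"
    using assms(4) by (rule locally_mono) blast
  then show "H \<subseteq> G" by (rule germs_subset[OF assms(1,3,2)])
qed

lemma germs_restrict:
  assumes G: "germs P a G" and ba: "b \<le> a"
  shows "germs P b {(c, x). (c, x) \<in> G \<and> c \<le> b}"
  unfolding germs_def
proof (intro conjI allI impI)
  fix c x
  assume "c \<le> b \<and> x \<in> sections P c \<and>
    locally c (\<lambda>d. (d, restr P c d x) \<in> {(c, x). (c, x) \<in> G \<and> c \<le> b})"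
  then have c: "c \<le> b" "x \<in> sections P c" "locally c (\<lambda>d. (d, restr P c d x) \<in> G \<and> d \<le> b)"
    by simp_all
  have "locally c (\<lambda>d. (d, restr P c d x) \<in> G)" using c(3) by (rule locally_mono) simp
  then show "(c, x) \<in> {(c, x). (c, x) \<in> G \<and> c \<le> b}"
    using germsD(4)[OF G order.trans[OF c(1) ba] c(2)] c(1) by simp
next
  fix c d x assume "(c, x) \<in> {(c, x). (c, x) \<in> G \<and> c \<le> b} \<and> d \<le> c"
  then show "(d, restr P c d x) \<in> {(c, x). (c, x) \<in> G \<and> c \<le> b}"
    using germsD(3)[OF G, of c x d] order.trans[of d c b] by simp
next
  show "locally b (\<lambda>c. \<exists>x. (c, x) \<in> {(c, x). (c, x) \<in> G \<and> c \<le> b})"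
    using germs_restrict_cover[OF assms] by (rule locally_mono) simp
next
  fix c x y
  assume "(c, x) \<in> {(c, x). (c, x) \<in> G \<and> c \<le> b} \<and> (c, y) \<in> {(c, x). (c, x) \<in> G \<and> c \<le> b}"
  then show "locally c (\<lambda>d. restr P c d x = restr P c d y)"
    using germsD(5)[OF G, of c x y] by simp
qed (use germsD(2)[OF G] in simp_all)

lemma presheaf_sheafify: "presheaf (sheafify P)"
  unfolding presheaf_def
proof (intro conjI allI impI)
  fix a b c and G :: "('a \<times> 'b) set"
  assume "c \<le> b \<and> b \<le> a \<and> G \<in> sections (sheafify P) a"
  then have "c \<le> b" by blast
  then show "restr (sheafify P) b c (restr (sheafify P) a b G) = restr (sheafify P) a c G"
    by (auto simp: sheafify_def dest: order.trans)
qed (auto simp: sheafify_def germs_restrict dest: germsD(1))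

lemma sheaf_sheafify:
  assumes P: "presheaf P" shows "sheaf (sheafify P)"
  unfolding sheaf_def
proof (intro conjI allI impI)
  show "presheaf (sheafify P)" by (rule presheaf_sheafify)
  fix B F assume "matching (sheafify P) B F"
  then have F: "\<And>b. b \<in> B \<Longrightarrow> germs P b (F b)"
    and eq: "\<And>b c. b \<in> B \<Longrightarrow> c \<in> B \<Longrightarrow>
      {(d, x). (d, x) \<in> F b \<and> d \<le> inf b c} = {(d, x). (d, x) \<in> F c \<and> d \<le> inf b c}"
    unfolding matching_def sheafify_def psh.simps mem_Collect_eq by blast+
  have tr: "(d, x) \<in> F c" if "(d, x) \<in> F b" "d \<le> c" "b \<in> B" "c \<in> B" for b c d x
    using eq[OF that(3,4)] that germsD(1)[OF F[OF that(3)] that(1)] by (auto simp: set_eq_iff)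
  define G where "G = {(c, x). c \<le> Sup B \<and> x \<in> sections P c \<and>
    locally c (\<lambda>d. \<exists>b\<in>B. (d, restr P c d x) \<in> F b)}"
  have down: "\<exists>b\<in>B. (d', restr P c d' x) \<in> F b"
    if "x \<in> sections P c" "d \<le> c" "d' \<le> d" "\<exists>b\<in>B. (d, restr P c d x) \<in> F b" for c x d d'
    using that germsD(3)[OF F] presheaf_restr(3)[OF P that(1,3,2)] by metis
  have sub: "(c, x) \<in> G" if "b \<in> B" "(c, x) \<in> F b" for b c x
  proof -
    have "c \<le> Sup B" "x \<in> sections P c"
      using germsD(1,2)[OF F[OF that(1)] that(2)] Sup_upper[OF that(1)] by auto
    moreover have "locally c (\<lambda>d. \<exists>b\<in>B. (d, restr P c d x) \<in> F b)"
      using that presheaf_restr(2)[OF P] calculation by (intro locallyI) auto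
    ultimately show ?thesis unfolding G_def by auto
  qed
  have G: "germs P (Sup B) G"
    unfolding germs_def
  proof (intro conjI allI impI)
    fix b c x assume "(b, x) \<in> G \<and> c \<le> b"
    then have b: "b \<le> Sup B" "x \<in> sections P b" "c \<le> b"
      "locally b (\<lambda>d. \<exists>b'\<in>B. (d, restr P b d x) \<in> F b')" unfolding G_def by auto
    have "locally c (\<lambda>d. \<exists>b'\<in>B. (d, restr P b d x) \<in> F b')"
      using b(4,3) by (rule locally_restrict) (use down[OF b(2)] in blast)
    then have "locally c (\<lambda>d. \<exists>b'\<in>B. (d, restr P c d (restr P b c x)) \<in> F b')"
      by (rule locally_mono) (use presheaf_restr(3)[OF P b(2) _ b(3)] in auto)
    then show "(c, restr P b c x) \<in> G"
      unfolding G_def using b presheaf_restr(1)[OF P b(2,3)] by auto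
  next
    fix b x
    assume "b \<le> Sup B \<and> x \<in> sections P b \<and> locally b (\<lambda>c. (c, restr P b c x) \<in> G)"
    then have b: "b \<le> Sup B" "x \<in> sections P b" "locally b (\<lambda>c. (c, restr P b c x) \<in> G)" by auto
    have "locally b (\<lambda>d. \<exists>b'\<in>B. (d, restr P b d x) \<in> F b')"
    proof (rule locally_trans[OF b(3)])
      fix c assume c: "c \<le> b" "(c, restr P b c x) \<in> G"
      then have "locally c (\<lambda>d. \<exists>b'\<in>B. (d, restr P c d (restr P b c x)) \<in> F b')"
        unfolding G_def by auto
      then show "locally c (\<lambda>d. \<exists>b'\<in>B. (d, restr P b d x) \<in> F b')"
        by (rule locally_mono) (use presheaf_restr(3)[OF P b(2) _ c(1)] in auto)
    qed
    then show "(b, x) \<in> G" unfolding G_def using b by auto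
  next
    fix b x y assume "(b, x) \<in> G \<and> (b, y) \<in> G"
    then have x: "x \<in> sections P b" "locally b (\<lambda>d. \<exists>b'\<in>B. (d, restr P b d x) \<in> F b')"
      and y: "y \<in> sections P b" "locally b (\<lambda>d. \<exists>b'\<in>B. (d, restr P b d y) \<in> F b')"
      unfolding G_def by auto
    have "locally b (\<lambda>d. (\<exists>b'\<in>B. (d, restr P b d x) \<in> F b') \<and> (\<exists>b'\<in>B. (d, restr P b d y) \<in> F b'))"
      using x(2) y(2) by (rule locally_conj) (use down[OF x(1)] down[OF y(1)] in blast)+
    then show "locally b (\<lambda>c. restr P b c x = restr P b c y)"
    proof (rule locally_trans)
      fix d assume d: "d \<le> b"
        "(\<exists>b'\<in>B. (d, restr P b d x) \<in> F b') \<and> (\<exists>b'\<in>B. (d, restr P b d y) \<in> F b')"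
      then obtain c c' where c: "c \<in> B" "(d, restr P b d x) \<in> F c"
        and c': "c' \<in> B" "(d, restr P b d y) \<in> F c'" by blast
      have "(d, restr P b d y) \<in> F c"
        using tr[OF c'(2) germsD(1)[OF F[OF c(1)] c(2)] c'(1) c(1)] .
      from germsD(5)[OF F[OF c(1)] c(2) this]
      show "locally d (\<lambda>c. restr P b c x = restr P b c y)"
        by (rule locally_mono)
           (use presheaf_restr(3)[OF P x(1) _ d(1)] presheaf_restr(3)[OF P y(1) _ d(1)] in auto)
    qed
  next
    show "locally (Sup B) (\<lambda>b. \<exists>x. (b, x) \<in> G)"
    proof (rule locally_Sup)
      fix b assume "b \<in> B"
      show "locally b (\<lambda>b. \<exists>x. (b, x) \<in> G)"
        using germsD(6)[OF F[OF \<open>b \<in> B\<close>]] by (rule locally_mono) (use sub \<open>b \<in> B\<close> in blast)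
    qed
  qed (auto simp: G_def)
  have res: "{(c, x). (c, x) \<in> G \<and> c \<le> b} = F b" if b: "b \<in> B" for b
  proof (rule germs_eqI[OF P germs_restrict[OF G Sup_upper[OF b]] F[OF b], symmetric, THEN sym])
    show "locally b (\<lambda>c. \<exists>x. (c, x) \<in> {(c, x). (c, x) \<in> G \<and> c \<le> b} \<and> (c, x) \<in> F b)"
      using germsD(6)[OF F[OF b]]
      by (rule locally_mono) (use sub[OF b] germsD(1)[OF F[OF b]] in blast)
  qed
  show "\<exists>!y. y \<in> sections (sheafify P) (Sup B) \<and>
    (\<forall>b\<in>B. restr (sheafify P) (Sup B) b y = F b)"
  proof (rule ex1I[of _ G], goal_cases)
    case 1
    show ?case using G res by (simp add: sheafify_def)
  next
    case (2 H)
    then have H: "germs P (Sup B) H" "\<And>b. b \<in> B \<Longrightarrow> {(c, x). (c, x) \<in> H \<and> c \<le> b} = F b"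
      by (simp_all add: sheafify_def)
    show "H = G"
    proof (rule germs_eqI[OF P H(1) G], rule locally_Sup)
      fix b assume b: "b \<in> B"
      show "locally b (\<lambda>c. \<exists>x. (c, x) \<in> H \<and> (c, x) \<in> G)"
        using germsD(6)[OF F[OF b]] by (rule locally_mono) (use H(2)[OF b] sub[OF b] in blast)
    qed
  qed
qed

lemma germs_unit:
  assumes P: "presheaf P" and x: "x \<in> sections P a"
  shows "germs P a (sheafify_unit P a x)"
  unfolding germs_def
proof (intro conjI allI impI)
  fix b c y assume "(b, y) \<in> sheafify_unit P a x \<and> c \<le> b"
  then have b: "b \<le> a" "y \<in> sections P b" "c \<le> b"
    "locally b (\<lambda>c. restr P b c y = restr P a c x)" unfolding sheafify_unit_def by auto
  have "locally c (\<lambda>d. restr P b d y = restr P a d x)"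
    using b(4,3)
    by (rule locally_restrict)
       (metis P presheaf_restr(3) b(1,2) x order.trans)
  then have "locally c (\<lambda>d. restr P c d (restr P b c y) = restr P a d x)"
    by (rule locally_mono) (use presheaf_restr(3)[OF P b(2) _ b(3)] in auto)
  then show "(c, restr P b c y) \<in> sheafify_unit P a x"
    unfolding sheafify_unit_def using b presheaf_restr(1)[OF P b(2,3)] by auto
next
  fix b y
  assume "b \<le> a \<and> y \<in> sections P b \<and> locally b (\<lambda>c. (c, restr P b c y) \<in> sheafify_unit P a x)"
  then have b: "b \<le> a" "y \<in> sections P b"
    and loc: "locally b (\<lambda>c. (c, restr P b c y) \<in> sheafify_unit P a x)" by auto
  have "locally b (\<lambda>c. restr P b c y = restr P a c x)"
  proof (rule locally_trans[OF loc])
    fix c assume c: "c \<le> b" "(c, restr P b c y) \<in> sheafify_unit P a x"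
    then have "locally c (\<lambda>d. restr P c d (restr P b c y) = restr P a d x)"
      unfolding sheafify_unit_def by auto
    then show "locally c (\<lambda>d. restr P b d y = restr P a d x)"
      by (rule locally_mono) (use presheaf_restr(3)[OF P b(2) _ c(1)] in auto)
  qed
  then show "(b, y) \<in> sheafify_unit P a x" unfolding sheafify_unit_def using b by auto
next
  fix b y z assume "(b, y) \<in> sheafify_unit P a x \<and> (b, z) \<in> sheafify_unit P a x"
  then have b: "b \<le> a" "y \<in> sections P b" "z \<in> sections P b"
    and loc: "locally b (\<lambda>c. restr P b c y = restr P a c x)"
      "locally b (\<lambda>c. restr P b c z = restr P a c x)" unfolding sheafify_unit_def by auto
  have "locally b (\<lambda>c. restr P b c y = restr P a c x \<and> restr P b c z = restr P a c x)"
    using loc by (rule locally_conj) (metis P presheaf_restr(3) b x order.trans)+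
  then show "locally b (\<lambda>c. restr P b c y = restr P b c z)" by (rule locally_mono) auto
next
  have "(a, x) \<in> sheafify_unit P a x" unfolding sheafify_unit_def using x by (auto intro: locallyI)
  then show "locally a (\<lambda>b. \<exists>y. (b, y) \<in> sheafify_unit P a x)" by (intro locallyI) blast
qed (auto simp: sheafify_unit_def)

lemma unit_self: "x \<in> sections P a \<Longrightarrow> (a, x) \<in> sheafify_unit P a x"
  unfolding sheafify_unit_def by (auto intro: locallyI)

lemma germs_restrict_unit:
  assumes P: "presheaf P" and G: "germs P a G" and bx: "(b, x) \<in> G"
  shows "{(c, y). (c, y) \<in> G \<and> c \<le> b} = sheafify_unit P b x"
proof (rule germs_eqI[OF P germs_restrict[OF G germsD(1)[OF G bx]]
      germs_unit[OF P germsD(2)[OF G bx]]], rule locallyI)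
  show "\<exists>y. (b, y) \<in> {(c, y). (c, y) \<in> G \<and> c \<le> b} \<and> (b, y) \<in> sheafify_unit P b x"
    using bx unit_self[OF germsD(2)[OF G bx]] by blast
qed

lemma sheafify_unit_hom:
  assumes P: "presheaf P" shows "psh_hom P (sheafify P) (sheafify_unit P)"
  unfolding psh_hom_def
proof (intro conjI allI impI)
  fix a b x assume "b \<le> a \<and> x \<in> sections P a"
  then have x: "b \<le> a" "x \<in> sections P a" by auto
  note G = germs_unit[OF P x(2)]
  show "sheafify_unit P b (restr P a b x) = restr (sheafify P) a b (sheafify_unit P a x)"
    using germs_restrict_unit[OF P G germsD(3)[OF G unit_self[OF x(2)] x(1)]]
    by (simp add: sheafify_def)
qed (use germs_unit[OF P] in \<open>auto simp: sheafify_def\<close>)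

theorem sheafify_universal:
  assumes P: "presheaf P" and Y: "sheaf Y" and f: "psh_hom P Y f"
  shows "\<exists>g. psh_hom (sheafify P) Y g \<and>
     (\<forall>a. \<forall>x\<in>sections P a. g a (sheafify_unit P a x) = f a x)"
    and "psh_hom (sheafify P) Y g \<Longrightarrow> psh_hom (sheafify P) Y g' \<Longrightarrow>
      (\<And>a x. x \<in> sections P a \<Longrightarrow> g a (sheafify_unit P a x) = f a x) \<Longrightarrow>
      (\<And>a x. x \<in> sections P a \<Longrightarrow> g' a (sheafify_unit P a x) = f a x) \<Longrightarrow>
      G \<in> sections (sheafify P) a \<Longrightarrow> g a G = g' a G"
proof -
  note RY = presheaf_restr[OF sheaf_presheaf[OF Y]]
  have fS: "\<And>a x. x \<in> sections P a \<Longrightarrow> f a x \<in> sections Y a"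
    and fN: "\<And>a b x. b \<le> a \<Longrightarrow> x \<in> sections P a \<Longrightarrow> f b (restr P a b x) = restr Y a b (f a x)"
    using f unfolding psh_hom_def by blast+
  have feq: "f b x = f b y" if "germs P a G" "(b, x) \<in> G" "(b, y) \<in> G" for a b x y G
  proof (rule sheaf_separated[OF Y])
    show "locally b (\<lambda>c. restr Y b c (f b x) = restr Y b c (f b y))"
      using germsD(5)[OF that] by (rule locally_mono) (metis fN germsD(2)[OF that(1)] that(2,3))
  qed (use fS germsD(2)[OF that(1)] that in auto)
  have uniq: "y = y'" if G: "germs P a G" and "y \<in> sections Y a" "y' \<in> sections Y a"
    and "\<And>b x. (b, x) \<in> G \<Longrightarrow> restr Y a b y = f b x"
    and "\<And>b x. (b, x) \<in> G \<Longrightarrow> restr Y a b y' = f b x" for a G y y'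
    using that by (intro sheaf_separated[OF Y that(2,3)] locally_mono[OF germsD(6)[OF G]]) metis
  have ex: "\<exists>y. y \<in> sections Y a \<and> (\<forall>b x. (b, x) \<in> G \<longrightarrow> restr Y a b y = f b x)"
    if G: "germs P a G" for a G
  proof -
    define B where "B = {b. \<exists>x. (b, x) \<in> G}"
    have B: "Sup B = a"

    proof -
      have "B = {b. b \<le> a \<and> (\<exists>x. (b, x) \<in> G)}" unfolding B_def using germsD(1)[OF G] by blast
      then show ?thesis using germsD(6)[OF G] by (simp add: locally_def)
    qed
    define s where "s b = f b (SOME x. (b, x) \<in> G)" for b
    have s: "s b = f b x" if "(b, x) \<in> G" for b x
      unfolding s_def using someI[of "\<lambda>x. (b, x) \<in> G", OF that] that by (intro feq[OF G])
    have "matching Y B s"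
      unfolding matching_def
    proof (intro conjI ballI)
      fix b assume "b \<in> B"
      then show "s b \<in> sections Y b" using s fS germsD(2)[OF G] by (auto simp: B_def)
    next
      fix b c assume "b \<in> B" "c \<in> B"
      then obtain x y where x: "(b, x) \<in> G" and y: "(c, y) \<in> G" by (auto simp: B_def)
      have "f (inf b c) (restr P b (inf b c) x) = f (inf b c) (restr P c (inf b c) y)"
        using germsD(3)[OF G x] germsD(3)[OF G y] by (intro feq[OF G]) auto
      then show "restr Y b (inf b c) (s b) = restr Y c (inf b c) (s c)"
        using s[OF x] s[OF y] fN germsD(2)[OF G] x y by simp
    qed
    then have "\<exists>y. y \<in> sections Y (Sup B) \<and> (\<forall>b\<in>B. restr Y (Sup B) b y = s b)"
      using Y unfolding sheaf_def by blast
    then obtain y where y: "y \<in> sections Y a" "\<forall>b\<in>B. restr Y a b y = s b" unfolding B by blast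
    have "restr Y a b y = f b x" if "(b, x) \<in> G" for b x
      using y(2) s[OF that] that by (auto simp: B_def)
    then show ?thesis using y(1) by blast
  qed
  define g where "g a G = (SOME y. y \<in> sections Y a \<and> (\<forall>b x. (b, x) \<in> G \<longrightarrow> restr Y a b y = f b x))" for a G
  have g: "g a G \<in> sections Y a" "\<And>b x. (b, x) \<in> G \<Longrightarrow> restr Y a b (g a G) = f b x"
    if "germs P a G" for a G
    using someI_ex[OF ex[OF that]] unfolding g_def by auto
  have "psh_hom (sheafify P) Y g"
    unfolding psh_hom_def
  proof (intro conjI allI impI)
    fix a b G assume "b \<le> a \<and> G \<in> sections (sheafify P) a"
    then have b: "b \<le> a" and G: "germs P a G" by (auto simp: sheafify_def)
    let ?H = "{(c, x). (c, x) \<in> G \<and> c \<le> b}"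
    note H = germs_restrict[OF G b]
    have "g b ?H = restr Y a b (g a G)"
    proof (rule uniq[OF H g(1)[OF H] RY(1)[OF g(1)[OF G] b] g(2)[OF H]])
      fix c x assume "(c, x) \<in> ?H"
      then show "restr Y b c (restr Y a b (g a G)) = f c x"
        using RY(3)[OF g(1)[OF G] _ b] g(2)[OF G] by auto
    qed
    then show "g b (restr (sheafify P) a b G) = restr Y a b (g a G)" by (simp add: sheafify_def)
  qed (use g(1) in \<open>simp add: sheafify_def\<close>)
  moreover have "g a (sheafify_unit P a x) = f a x" if "x \<in> sections P a" for a x
    using g(2)[OF germs_unit[OF P that] unit_self[OF that]]
      RY(2)[OF g(1)[OF germs_unit[OF P that]]] by simp
  ultimately show "\<exists>g. psh_hom (sheafify P) Y g \<and>
     (\<forall>a. \<forall>x\<in>sections P a. g a (sheafify_unit P a x) = f a x)" by blast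
next
  assume g: "psh_hom (sheafify P) Y g" "psh_hom (sheafify P) Y g'"
    and u: "\<And>a x. x \<in> sections P a \<Longrightarrow> g a (sheafify_unit P a x) = f a x"
      "\<And>a x. x \<in> sections P a \<Longrightarrow> g' a (sheafify_unit P a x) = f a x"
    and "G \<in> sections (sheafify P) a"
  then have G: "germs P a G" "G \<in> sections (sheafify P) a" by (auto simp: sheafify_def)
  show "g a G = g' a G"
  proof (rule sheaf_separated[OF Y])
    show "locally a (\<lambda>b. restr Y a b (g a G) = restr Y a b (g' a G))"
      using germsD(6)[OF G(1)]
    proof (rule locally_mono)
      fix b assume b: "b \<le> a" "\<exists>x. (b, x) \<in> G"
      then obtain x where x: "(b, x) \<in> G" by blast
      have "restr (sheafify P) a b G = sheafify_unit P b x"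
        using germs_restrict_unit[OF P G(1) x] by (simp add: sheafify_def)
      then show "restr Y a b (g a G) = restr Y a b (g' a G)"
        using g u germsD(2)[OF G(1) x] b(1) G(2) unfolding psh_hom_def by metis
    qed
  qed (use g G in \<open>auto simp: psh_hom_def\<close>)
qed

definition sheafify_map ::
  "('a::complete_heyting_algebra, 't) psh \<Rightarrow> ('a \<Rightarrow> 's \<Rightarrow> 't) \<Rightarrow>
     'a \<Rightarrow> ('a \<times> 's) set \<Rightarrow> ('a \<times> 't) set" where
  "sheafify_map Q f a G =
     {(b, y). b \<le> a \<and> y \<in> sections Q b \<and>
        locally b (\<lambda>c. \<exists>x. (c, x) \<in> G \<and> f c x = restr Q b c y)}"

lemma sheafify_map_mem:
  assumes Q: "presheaf Q" and f: "psh_hom P Q f" and G: "germs P a G" and x: "(c, x) \<in> G"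
  shows "(c, f c x) \<in> sheafify_map Q f a G"
proof -
  have "f c x \<in> sections Q c" using f germsD(2)[OF G x] unfolding psh_hom_def by blast
  moreover from this have "f c x = restr Q c c (f c x)" using presheaf_restr(2)[OF Q] by metis
  moreover from this have "locally c (\<lambda>d. \<exists>y. (d, y) \<in> G \<and> f d y = restr Q c d (f c x))"
    by (intro locallyI) (use x in blast)
  ultimately show ?thesis unfolding sheafify_map_def using germsD(1)[OF G x] by simp
qed

lemma sheafify_map_hom:
  assumes P: "presheaf P" and Q: "presheaf Q" and f: "psh_hom P Q f"
  shows "psh_hom (sheafify P) (sheafify Q) (sheafify_map Q f)"
    and "x \<in> sections P a \<Longrightarrow>
      sheafify_map Q f a (sheafify_unit P a x) = sheafify_unit Q a (f a x)"
proof -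
  have fS: "\<And>a x. x \<in> sections P a \<Longrightarrow> f a x \<in> sections Q a"
    and fN: "\<And>a b x. b \<le> a \<Longrightarrow> x \<in> sections P a \<Longrightarrow> f b (restr P a b x) = restr Q a b (f a x)"
    using f unfolding psh_hom_def by blast+
  have down: "\<exists>x. (d, x) \<in> G \<and> f d x = restr Q b d y"
    if G: "germs P a G" and y: "y \<in> sections Q b" and c: "c \<le> b" "d \<le> c"
      "\<exists>x. (c, x) \<in> G \<and> f c x = restr Q b c y" for a G b y c d
  proof -
    from c(3) obtain x where x: "(c, x) \<in> G" "f c x = restr Q b c y" by blast
    have "f d (restr P c d x) = restr Q b d y"
      using fN[OF c(2) germsD(2)[OF G x(1)]] presheaf_restr(3)[OF Q y c(2,1)] x(2) by simp
    then show ?thesis using germsD(3)[OF G x(1) c(2)] by blast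
  qed
  note sub = sheafify_map_mem[OF Q f]
  have germs: "germs Q a (sheafify_map Q f a G)" if G: "germs P a G" for a G
    unfolding germs_def
  proof (intro conjI allI impI)
    fix b c y assume "(b, y) \<in> sheafify_map Q f a G \<and> c \<le> b"
    then have b: "b \<le> a" "y \<in> sections Q b" "c \<le> b"
      and loc: "locally b (\<lambda>d. \<exists>x. (d, x) \<in> G \<and> f d x = restr Q b d y)"
      unfolding sheafify_map_def by simp_all
    have "locally c (\<lambda>d. \<exists>x. (d, x) \<in> G \<and> f d x = restr Q b d y)"
      using loc b(3) by (rule locally_restrict) (rule down[OF G b(2)])
    then have "locally c (\<lambda>d. \<exists>x. (d, x) \<in> G \<and> f d x = restr Q c d (restr Q b c y))"
      by (rule locally_mono) (simp add: presheaf_restr(3)[OF Q b(2) _ b(3)])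
    then show "(c, restr Q b c y) \<in> sheafify_map Q f a G"
      unfolding sheafify_map_def using b presheaf_restr(1)[OF Q b(2,3)] by auto
  next
    fix b y
    assume "b \<le> a \<and> y \<in> sections Q b \<and> locally b (\<lambda>c. (c, restr Q b c y) \<in> sheafify_map Q f a G)"
    then have b: "b \<le> a" "y \<in> sections Q b"
      and loc: "locally b (\<lambda>c. (c, restr Q b c y) \<in> sheafify_map Q f a G)" by blast+
    have "locally b (\<lambda>d. \<exists>x. (d, x) \<in> G \<and> f d x = restr Q b d y)"
    proof (rule locally_trans[OF loc])
      fix c assume c: "c \<le> b" "(c, restr Q b c y) \<in> sheafify_map Q f a G"
      then have "locally c (\<lambda>d. \<exists>x. (d, x) \<in> G \<and> f d x = restr Q c d (restr Q b c y))"
        unfolding sheafify_map_def by simp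
      then show "locally c (\<lambda>d. \<exists>x. (d, x) \<in> G \<and> f d x = restr Q b d y)"
        by (rule locally_mono) (simp add: presheaf_restr(3)[OF Q b(2) _ c(1)])
    qed
    then show "(b, y) \<in> sheafify_map Q f a G" unfolding sheafify_map_def using b by simp
  next
    fix b y z assume "(b, y) \<in> sheafify_map Q f a G \<and> (b, z) \<in> sheafify_map Q f a G"
    then have b: "b \<le> a" "y \<in> sections Q b" "z \<in> sections Q b"
      and loc: "locally b (\<lambda>d. \<exists>x. (d, x) \<in> G \<and> f d x = restr Q b d y)"
        "locally b (\<lambda>d. \<exists>x. (d, x) \<in> G \<and> f d x = restr Q b d z)"
      unfolding sheafify_map_def by simp_all
    have "locally b (\<lambda>d. (\<exists>x. (d, x) \<in> G \<and> f d x = restr Q b d y) \<and>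
        (\<exists>x. (d, x) \<in> G \<and> f d x = restr Q b d z))"
      using loc by (rule locally_conj) (rule down[OF G b(2)], assumption+, rule down[OF G b(3)])
    then show "locally b (\<lambda>c. restr Q b c y = restr Q b c z)"
    proof (rule locally_trans)
      fix d assume d: "d \<le> b" "(\<exists>x. (d, x) \<in> G \<and> f d x = restr Q b d y) \<and>
        (\<exists>x. (d, x) \<in> G \<and> f d x = restr Q b d z)"
      then obtain u v where u: "(d, u) \<in> G" "f d u = restr Q b d y"
        and v: "(d, v) \<in> G" "f d v = restr Q b d z" by blast
      show "locally d (\<lambda>c. restr Q b c y = restr Q b c z)"
        using germsD(5)[OF G u(1) v(1)]
      proof (rule locally_mono)
        fix c assume c: "c \<le> d" "restr P d c u = restr P d c v"
        then show "restr Q b c y = restr Q b c z"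
          using fN[OF c(1) germsD(2)[OF G u(1)]] fN[OF c(1) germsD(2)[OF G v(1)]] u(2) v(2)
            presheaf_restr(3)[OF Q b(2) c(1) d(1)] presheaf_restr(3)[OF Q b(3) c(1) d(1)] by simp
      qed
    qed
  next
    show "locally a (\<lambda>b. \<exists>y. (b, y) \<in> sheafify_map Q f a G)"
      using germsD(6)[OF G] by (rule locally_mono) (use sub[OF G] in blast)
  qed (simp_all add: sheafify_map_def)
  show "psh_hom (sheafify P) (sheafify Q) (sheafify_map Q f)"
    unfolding psh_hom_def
  proof (intro conjI allI impI)
    fix a b G assume "b \<le> a \<and> G \<in> sections (sheafify P) a"
    then have b: "b \<le> a" and G: "germs P a G" by (simp_all add: sheafify_def)
    have "sheafify_map Q f b {(c, x). (c, x) \<in> G \<and> c \<le> b} =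
      {(c, y). (c, y) \<in> sheafify_map Q f a G \<and> c \<le> b}"
    proof -
      have "locally c (\<lambda>d. \<exists>x. ((d, x) \<in> G \<and> d \<le> b) \<and> f d x = restr Q c d y) \<longleftrightarrow>
        locally c (\<lambda>d. \<exists>x. (d, x) \<in> G \<and> f d x = restr Q c d y)" if "c \<le> b" for c y
        by (rule locally_cong) (use that in \<open>auto dest: order.trans\<close>)
      then show ?thesis unfolding sheafify_map_def using b by (auto dest: order.trans)
    qed
    then show "sheafify_map Q f b (restr (sheafify P) a b G) =
      restr (sheafify Q) a b (sheafify_map Q f a G)" by (simp add: sheafify_def)
  qed (simp add: sheafify_def germs)
  assume x: "x \<in> sections P a"
  note u = germs_unit[OF P x]
  show "sheafify_map Q f a (sheafify_unit P a x) = sheafify_unit Q a (f a x)"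
  proof (rule germs_eqI[OF Q germs[OF u] germs_unit[OF Q fS[OF x]]], rule locallyI)
    show "\<exists>y. (a, y) \<in> sheafify_map Q f a (sheafify_unit P a x) \<and>
      (a, y) \<in> sheafify_unit Q a (f a x)"
      using sub[OF u unit_self[OF x]] unit_self[OF fS[OF x]] by blast
  qed
qed

section \<open>The later functor\<close>

definition later_pre ::
  "'a::complete_heyting_algebra set \<Rightarrow> ('a, 's) psh \<Rightarrow> ('a, 's) psh" where
  "later_pre K X =
     \<lparr>sections = (\<lambda>a. sections X (predecessor K a)),
      restr = (\<lambda>a b. restr X (predecessor K a) (predecessor K b))\<rparr>"

definition later ::
  "'a::complete_heyting_algebra set \<Rightarrow> ('a, 's) psh \<Rightarrow> ('a, ('a \<times> 's) set) psh" where
  "later K X = sheafify (later_pre K X)"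

definition later_map ::
  "'a::complete_heyting_algebra set \<Rightarrow> ('a, 't) psh \<Rightarrow> ('a \<Rightarrow> 's \<Rightarrow> 't) \<Rightarrow>
     'a \<Rightarrow> ('a \<times> 's) set \<Rightarrow> ('a \<times> 't) set" where
  "later_map K Y f = sheafify_map (later_pre K Y) (\<lambda>a. f (predecessor K a))"

definition next_pre ::
  "'a::complete_heyting_algebra set \<Rightarrow> ('a, 's) psh \<Rightarrow> 'a \<Rightarrow> 's \<Rightarrow> 's" where
  "next_pre K X a x = restr X a (predecessor K a) x"

text \<open>The unit is the canonical isomorphism between a sheaf and its associated sheaf.\<close>

definition next_map ::
  "'a::complete_heyting_algebra set \<Rightarrow> ('a, 's) psh \<Rightarrow> 'a \<Rightarrow> 's \<Rightarrow> ('a \<times> 's) set" where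
  "next_map K X a x = sheafify_map (later_pre K X) (next_pre K X) a (sheafify_unit X a x)"

lemma predecessor_mono: "b \<le> a \<Longrightarrow> predecessor K b \<le> predecessor K a"
  unfolding predecessor_def by (rule Sup_subset_mono) (auto dest: order.strict_trans2)

lemma predecessor_le: "predecessor K a \<le> a"
  unfolding predecessor_def by (rule Sup_least) (simp add: less_imp_le)

lemma presheaf_later_pre: "presheaf X \<Longrightarrow> presheaf (later_pre K X)"
  unfolding presheaf_def later_pre_def by (simp add: predecessor_mono)

lemma later_pre_hom:
  "psh_hom X Y f \<Longrightarrow> psh_hom (later_pre K X) (later_pre K Y) (\<lambda>a. f (predecessor K a))"
  unfolding psh_hom_def later_pre_def by (simp add: predecessor_mono)

lemma next_pre_hom: "presheaf X \<Longrightarrow> psh_hom X (later_pre K X) (next_pre K X)"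
  unfolding psh_hom_def later_pre_def next_pre_def presheaf_def
  by (auto simp: predecessor_mono predecessor_le)

lemma presheaf_prod: "presheaf X \<Longrightarrow> presheaf Y \<Longrightarrow> presheaf (prod_psh X Y)"
  unfolding presheaf_def prod_psh_def by auto

lemma later_sheaf: "presheaf X \<Longrightarrow> sheaf (later K X)"
  unfolding later_def by (intro sheaf_sheafify presheaf_later_pre)

lemma later_map_hom:
  "presheaf X \<Longrightarrow> presheaf Y \<Longrightarrow> psh_hom X Y f \<Longrightarrow> psh_hom (later K X) (later K Y) (later_map K Y f)"
  unfolding later_def later_map_def
  by (intro sheafify_map_hom(1) presheaf_later_pre later_pre_hom)

lemma next_map_eq:
  "presheaf X \<Longrightarrow> x \<in> sections X a \<Longrightarrow>
    next_map K X a x = sheafify_unit (later_pre K X) a (next_pre K X a x)"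
  unfolding next_map_def
  by (intro sheafify_map_hom(2) presheaf_later_pre next_pre_hom)

lemma next_map_hom:
  assumes X: "presheaf X" shows "psh_hom X (later K X) (next_map K X)"
proof -
  have "psh_hom X (later K X) (\<lambda>a x. sheafify_unit (later_pre K X) a (next_pre K X a x))"
    using next_pre_hom[OF X, of K] sheafify_unit_hom[OF presheaf_later_pre[OF X, of K]]
    unfolding psh_hom_def later_def by simp
  then show ?thesis
    using next_map_eq[OF X] X unfolding psh_hom_def presheaf_def by simp
qed

text \<open>The canonical isomorphism from the product of the \<open>later\<close>s to the \<open>later\<close> of the product,
  shown below to be inverse to the map induced by the projections.\<close>

definition later_pair :: "'a \<Rightarrow> ('a \<times> 's) set \<times> ('a \<times> 't) set \<Rightarrow> ('a \<times> 's \<times> 't) set" where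
  "later_pair a = (\<lambda>(G, H). {(b, x, y). (b, x) \<in> G \<and> (b, y) \<in> H})"

lemma germs_pair:
  assumes P: "presheaf P" and Q: "presheaf Q" and G: "germs P a G" and H: "germs Q a H"
  shows "germs (prod_psh P Q) a (later_pair a (G, H))"
  unfolding germs_def
proof (intro conjI allI impI)
  fix b and z :: "'b \<times> 'c"
  obtain x y where z: "z = (x, y)" by fastforce
  assume "b \<le> a \<and> z \<in> sections (prod_psh P Q) b \<and>
    locally b (\<lambda>c. (c, restr (prod_psh P Q) b c z) \<in> later_pair a (G, H))"
  then have b: "b \<le> a" "x \<in> sections P b" "y \<in> sections Q b"
    and loc: "locally b (\<lambda>c. (c, restr P b c x) \<in> G \<and> (c, restr Q b c y) \<in> H)"
    by (simp_all add: z prod_psh_def later_pair_def)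
  have "locally b (\<lambda>c. (c, restr P b c x) \<in> G)" "locally b (\<lambda>c. (c, restr Q b c y) \<in> H)"
    using loc by (rule locally_mono, blast)+
  then show "(b, z) \<in> later_pair a (G, H)"
    using germsD(4)[OF G b(1,2)] germsD(4)[OF H b(1,3)] by (simp add: z later_pair_def)
next
  fix b and z z' :: "'b \<times> 'c"
  obtain x y x' y' where z: "z = (x, y)" "z' = (x', y')" by fastforce
  assume "(b, z) \<in> later_pair a (G, H) \<and> (b, z') \<in> later_pair a (G, H)"
  then have m: "(b, x) \<in> G" "(b, x') \<in> G" "(b, y) \<in> H" "(b, y') \<in> H"
    by (simp_all add: z later_pair_def)
  have "locally b (\<lambda>c. restr P b c x = restr P b c x' \<and> restr Q b c y = restr Q b c y')"
    using germsD(5)[OF G m(1,2)] germsD(5)[OF H m(3,4)]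
    by (rule locally_conj)
       (metis presheaf_restr(3)[OF P] presheaf_restr(3)[OF Q] germsD(2)[OF G] germsD(2)[OF H] m)+
  then show "locally b (\<lambda>c. restr (prod_psh P Q) b c z = restr (prod_psh P Q) b c z')"
    by (simp add: z prod_psh_def)
next
  have "locally a (\<lambda>b. (\<exists>x. (b, x) \<in> G) \<and> (\<exists>y. (b, y) \<in> H))"
    using germsD(6)[OF G] germsD(6)[OF H]
    by (rule locally_conj) (use germsD(3)[OF G] germsD(3)[OF H] in blast)+
  then show "locally a (\<lambda>b. \<exists>z. (b, z) \<in> later_pair a (G, H))"
    by (rule locally_mono) (auto simp: later_pair_def)
qed (use germsD(1,2,3)[OF G] germsD(2,3)[OF H] in \<open>auto simp: later_pair_def prod_psh_def\<close>)

lemma later_pre_prod: "later_pre K (prod_psh X Y) = prod_psh (later_pre K X) (later_pre K Y)"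
  by (simp add: later_pre_def prod_psh_def)

lemma later_pair_hom:
  assumes X: "presheaf X" and Y: "presheaf Y"
  shows "psh_hom (prod_psh (later K X) (later K Y)) (later K (prod_psh X Y)) later_pair"
  unfolding psh_hom_def
proof (intro conjI allI impI)
  fix a and z :: "('a \<times> 'b) set \<times> ('a \<times> 'c) set"
  assume "z \<in> sections (prod_psh (later K X) (later K Y)) a"
  then obtain G H where z: "z = (G, H)" and "germs (later_pre K X) a G" "germs (later_pre K Y) a H"
    by (auto simp: later_def sheafify_def prod_psh_def)
  then have "germs (prod_psh (later_pre K X) (later_pre K Y)) a (later_pair a z)"
    unfolding z by (intro germs_pair presheaf_later_pre X Y)
  then show "later_pair a z \<in> sections (later K (prod_psh X Y)) a"
    unfolding later_def later_pre_prod by (simp add: sheafify_def)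
qed (auto simp: later_def sheafify_def prod_psh_def later_pair_def)

lemma later_pair_inverse:
  assumes X: "presheaf X" and Y: "presheaf Y"
  shows "G \<in> sections (later K X) a \<Longrightarrow> H \<in> sections (later K Y) a \<Longrightarrow>
      later_map K X (\<lambda>_. fst) a (later_pair a (G, H)) = G \<and>
      later_map K Y (\<lambda>_. snd) a (later_pair a (G, H)) = H"
    and "W \<in> sections (later K (prod_psh X Y)) a \<Longrightarrow>
      later_pair a (later_map K X (\<lambda>_. fst) a W, later_map K Y (\<lambda>_. snd) a W) = W"
proof -
  let ?X = "later_pre K X" and ?Y = "later_pre K Y"
  note X' = presheaf_later_pre[OF X, of K] and Y' = presheaf_later_pre[OF Y, of K]
  note XY = presheaf_prod[OF X Y]
  have p1: "psh_hom (prod_psh X Y) X (\<lambda>_. fst)" and p2: "psh_hom (prod_psh X Y) Y (\<lambda>_. snd)"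
    unfolding psh_hom_def prod_psh_def by auto
  have g1: "germs ?X a (later_map K X (\<lambda>_. fst) a W)"
    and g2: "germs ?Y a (later_map K Y (\<lambda>_. snd) a W)"
    if "W \<in> sections (later K (prod_psh X Y)) a" for W
    using later_map_hom[OF XY X p1, of K] later_map_hom[OF XY Y p2, of K] that
    unfolding psh_hom_def by (simp_all add: later_def sheafify_def)
  have sub: "(b, x) \<in> later_map K X (\<lambda>_. fst) a W" "(b, y) \<in> later_map K Y (\<lambda>_. snd) a W"
    if W: "germs (prod_psh ?X ?Y) a W" and xy: "(b, x, y) \<in> W" for W b x y
  proof -
    have m: "b \<le> a" "x \<in> sections ?X b" "y \<in> sections ?Y b"
      using germsD(1,2)[OF W xy] by (simp_all add: prod_psh_def)
    have "locally b (\<lambda>c. \<exists>z. (c, z) \<in> W \<and> fst z = restr ?X b c x)"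
      "locally b (\<lambda>c. \<exists>z. (c, z) \<in> W \<and> snd z = restr ?Y b c y)"
      using xy presheaf_restr(2)[OF X' m(2)] presheaf_restr(2)[OF Y' m(3)]
      by (intro locallyI exI[of _ "(x, y)"]; simp)+
    then show "(b, x) \<in> later_map K X (\<lambda>_. fst) a W" "(b, y) \<in> later_map K Y (\<lambda>_. snd) a W"
      using m by (simp_all add: later_map_def sheafify_map_def)
  qed
  {
    assume "G \<in> sections (later K X) a" "H \<in> sections (later K Y) a"
    then have G: "germs ?X a G" and H: "germs ?Y a H" by (simp_all add: later_def sheafify_def)
    note W = germs_pair[OF X' Y' G H]
    then have W': "later_pair a (G, H) \<in> sections (later K (prod_psh X Y)) a"
      by (simp add: later_def sheafify_def later_pre_prod)
    have loc: "locally a (\<lambda>b. \<exists>z. (b, z) \<in> later_pair a (G, H))" by (rule germsD(6)[OF W])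
    have *: "(b, x, y) \<in> later_pair a (G, H) \<Longrightarrow> (b, x) \<in> G \<and> (b, y) \<in> H" for b x y
      by (simp add: later_pair_def)
    have "later_map K X (\<lambda>_. fst) a (later_pair a (G, H)) = G"
      using loc by (intro germs_eqI[OF X' g1[OF W'] G], rule_tac locally_mono)
        (use sub[OF W] * in fast)+
    moreover have "later_map K Y (\<lambda>_. snd) a (later_pair a (G, H)) = H"
      using loc by (intro germs_eqI[OF Y' g2[OF W'] H], rule_tac locally_mono)
        (use sub[OF W] * in fast)+
    ultimately show "later_map K X (\<lambda>_. fst) a (later_pair a (G, H)) = G \<and>
      later_map K Y (\<lambda>_. snd) a (later_pair a (G, H)) = H" by blast
  }
  assume W': "W \<in> sections (later K (prod_psh X Y)) a"
  then have W: "germs (prod_psh ?X ?Y) a W" by (simp add: later_def sheafify_def later_pre_prod)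
  show "later_pair a (later_map K X (\<lambda>_. fst) a W, later_map K Y (\<lambda>_. snd) a W) = W"
  proof (rule germs_eqI[OF presheaf_prod[OF X' Y'] germs_pair[OF X' Y' g1[OF W'] g2[OF W']] W])
    show "locally a (\<lambda>b. \<exists>z. (b, z) \<in>
        later_pair a (later_map K X (\<lambda>_. fst) a W, later_map K Y (\<lambda>_. snd) a W) \<and> (b, z) \<in> W)"
      using germsD(6)[OF W] by (rule locally_mono) (use sub[OF W] in \<open>force simp: later_pair_def\<close>)
  qed
qed

section \<open>Ordinary categories, limits and completeness\<close>

record ('o, 'm) cat =
  objs :: "'o set"
  hom :: "'o \<Rightarrow> 'o \<Rightarrow> 'm set"
  comp :: "'o \<Rightarrow> 'o \<Rightarrow> 'o \<Rightarrow> 'm \<Rightarrow> 'm \<Rightarrow> 'm"  \<comment> \<open>\<open>comp C X Y Z g f\<close> for \<open>f : X \<rightarrow> Y\<close>, \<open>g : Y \<rightarrow> Z\<close>\<close>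
  ident :: "'o \<Rightarrow> 'm"

definition category :: "('o, 'm) cat \<Rightarrow> bool" where
  "category C \<longleftrightarrow>
     (\<forall>X\<in>objs C. \<forall>Y\<in>objs C. \<forall>Z\<in>objs C. \<forall>f\<in>hom C X Y. \<forall>g\<in>hom C Y Z.
        comp C X Y Z g f \<in> hom C X Z) \<and>
     (\<forall>X\<in>objs C. ident C X \<in> hom C X X) \<and>
     (\<forall>W\<in>objs C. \<forall>X\<in>objs C. \<forall>Y\<in>objs C. \<forall>Z\<in>objs C.
        \<forall>f\<in>hom C W X. \<forall>g\<in>hom C X Y. \<forall>h\<in>hom C Y Z.
        comp C W X Z (comp C X Y Z h g) f = comp C W Y Z h (comp C W X Y g f)) \<and>
     (\<forall>X\<in>objs C. \<forall>Y\<in>objs C. \<forall>f\<in>hom C X Y.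
        comp C X X Y f (ident C X) = f \<and> comp C X Y Y (ident C Y) f = f)"

definition isomorphic :: "('o, 'm) cat \<Rightarrow> 'o \<Rightarrow> 'o \<Rightarrow> bool" where
  "isomorphic C X Y \<longleftrightarrow>
     (\<exists>f\<in>hom C X Y. \<exists>g\<in>hom C Y X.
        comp C X Y X g f = ident C X \<and> comp C Y X Y f g = ident C Y)"

record ('i, 'm, 'o, 'n) diagram =
  dobj :: "'i \<Rightarrow> 'o"
  darr :: "'i \<Rightarrow> 'i \<Rightarrow> 'm \<Rightarrow> 'n"

definition is_diagram ::
  "('i, 'm) cat \<Rightarrow> ('o, 'n) cat \<Rightarrow> ('i, 'm, 'o, 'n) diagram \<Rightarrow> bool" where
  "is_diagram J C D \<longleftrightarrow>
     (\<forall>i\<in>objs J. dobj D i \<in> objs C) \<and>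
     (\<forall>i\<in>objs J. \<forall>j\<in>objs J. \<forall>u\<in>hom J i j. darr D i j u \<in> hom C (dobj D i) (dobj D j)) \<and>
     (\<forall>i\<in>objs J. darr D i i (ident J i) = ident C (dobj D i)) \<and>
     (\<forall>i\<in>objs J. \<forall>j\<in>objs J. \<forall>k\<in>objs J. \<forall>u\<in>hom J i j. \<forall>v\<in>hom J j k.
        darr D i k (comp J i j k v u) =
        comp C (dobj D i) (dobj D j) (dobj D k) (darr D j k v) (darr D i j u))"

definition cone ::
  "('i, 'm) cat \<Rightarrow> ('o, 'n) cat \<Rightarrow> ('i, 'm, 'o, 'n) diagram \<Rightarrow> 'o \<Rightarrow> ('i \<Rightarrow> 'n) \<Rightarrow> bool" where
  "cone J C D L p \<longleftrightarrow>
     L \<in> objs C \<and>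
     (\<forall>i\<in>objs J. p i \<in> hom C L (dobj D i)) \<and>
     (\<forall>i\<in>objs J. \<forall>j\<in>objs J. \<forall>u\<in>hom J i j.
        comp C L (dobj D i) (dobj D j) (darr D i j u) (p i) = p j)"

definition limit_cone ::
  "('i, 'm) cat \<Rightarrow> ('o, 'n) cat \<Rightarrow> ('i, 'm, 'o, 'n) diagram \<Rightarrow> 'o \<Rightarrow> ('i \<Rightarrow> 'n) \<Rightarrow> bool" where
  "limit_cone J C D L p \<longleftrightarrow>
     cone J C D L p \<and>
     (\<forall>M q. cone J C D M q \<longrightarrow>
        (\<exists>!h. h \<in> hom C M L \<and> (\<forall>i\<in>objs J. comp C M L (dobj D i) (p i) h = q i)))"

text \<open>A type \<open>'u\<close> plays the role of the universe: a set is small if it has fewer elements than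
  \<open>'u\<close>. For a Grothendieck universe this is the usual smallness, up to bijection. Up to
  isomorphism, every small index category has its objects and arrows in \<open>'u\<close>. No closure
  property of \<open>'u\<close> is built in, and hom-objects are not required to have small sets of
  sections, so completeness here is completeness below an arbitrary cardinal.\<close>

definition small :: "'u itself \<Rightarrow> 'b set \<Rightarrow> bool" where
  "small U S \<longleftrightarrow> |S| <o |UNIV :: 'u set|"

definition complete_category :: "'u itself \<Rightarrow> ('o, 'n) cat \<Rightarrow> bool" where
  "complete_category U C \<longleftrightarrow>
     (\<forall>(J :: ('u, 'u) cat) D.
        category J \<and> small U (objs J) \<and> small U (\<Union>i\<in>objs J. \<Union>j\<in>objs J. hom J i j) \<and>
        is_diagram J C D
        \<longrightarrow> (\<exists>L p. limit_cone J C D L p))"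

section \<open>Categories enriched in sheaves\<close>

record ('o, 'a, 's) ecat =
  eobjs :: "'o set"
  ehom :: "'o \<Rightarrow> 'o \<Rightarrow> ('a, 's) psh"
  ecomp :: "'o \<Rightarrow> 'o \<Rightarrow> 'o \<Rightarrow> 'a \<Rightarrow> 's \<times> 's \<Rightarrow> 's"
    \<comment> \<open>\<open>ecomp C X Y Z : Hom(Y, Z) \<times> Hom(X, Y) \<rightarrow> Hom(X, Z)\<close>\<close>
  eident :: "'o \<Rightarrow> 'a \<Rightarrow> unit \<Rightarrow> 's"

definition enriched_category :: "('o, 'a::complete_heyting_algebra, 's) ecat \<Rightarrow> bool" where
  "enriched_category C \<longleftrightarrow>
     (\<forall>X\<in>eobjs C. \<forall>Y\<in>eobjs C. sheaf (ehom C X Y)) \<and>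
     (\<forall>X\<in>eobjs C. \<forall>Y\<in>eobjs C. \<forall>Z\<in>eobjs C.
        psh_hom (prod_psh (ehom C Y Z) (ehom C X Y)) (ehom C X Z) (ecomp C X Y Z)) \<and>
     (\<forall>X\<in>eobjs C. psh_hom one_psh (ehom C X X) (eident C X)) \<and>
     (\<forall>W\<in>eobjs C. \<forall>X\<in>eobjs C. \<forall>Y\<in>eobjs C. \<forall>Z\<in>eobjs C. \<forall>a.
        \<forall>f\<in>sections (ehom C W X) a. \<forall>g\<in>sections (ehom C X Y) a. \<forall>h\<in>sections (ehom C Y Z) a.
        ecomp C W X Z a (ecomp C X Y Z a (h, g), f) =
        ecomp C W Y Z a (h, ecomp C W X Y a (g, f))) \<and>
     (\<forall>X\<in>eobjs C. \<forall>Y\<in>eobjs C. \<forall>a. \<forall>f\<in>sections (ehom C X Y) a.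
        ecomp C X X Y a (f, eident C X a ()) = f \<and>
        ecomp C X Y Y a (eident C Y a (), f) = f)"

definition externalisation ::
  "('o, 'a::complete_heyting_algebra, 's) ecat \<Rightarrow> ('o, 'a \<Rightarrow> unit \<Rightarrow> 's) cat" where
  "externalisation C =
     \<lparr>objs = eobjs C,
      hom = (\<lambda>X Y. {f. psh_hom one_psh (ehom C X Y) f}),
      comp = (\<lambda>X Y Z g f a u. ecomp C X Y Z a (g a u, f a u)),
      ident = eident C\<rparr>"

record ('o, 'p, 'a, 's, 't) efunctor =
  fobj :: "'o \<Rightarrow> 'p"
  farr :: "'o \<Rightarrow> 'o \<Rightarrow> 'a \<Rightarrow> 's \<Rightarrow> 't"

definition enriched_functor ::
  "('o, 'a::complete_heyting_algebra, 's) ecat \<Rightarrow> ('p, 'a, 't) ecat \<Rightarrow>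
     ('o, 'p, 'a, 's, 't) efunctor \<Rightarrow> bool" where
  "enriched_functor D C F \<longleftrightarrow>
     (\<forall>X\<in>eobjs D. fobj F X \<in> eobjs C) \<and>
     (\<forall>X\<in>eobjs D. \<forall>Y\<in>eobjs D.
        psh_hom (ehom D X Y) (ehom C (fobj F X) (fobj F Y)) (farr F X Y)) \<and>
     (\<forall>X\<in>eobjs D. \<forall>a. farr F X X a (eident D X a ()) = eident C (fobj F X) a ()) \<and>
     (\<forall>X\<in>eobjs D. \<forall>Y\<in>eobjs D. \<forall>Z\<in>eobjs D. \<forall>a.
        \<forall>f\<in>sections (ehom D X Y) a. \<forall>g\<in>sections (ehom D Y Z) a.
        farr F X Z a (ecomp D X Y Z a (g, f)) =
        ecomp C (fobj F X) (fobj F Y) (fobj F Z) a (farr F Y Z a g, farr F X Y a f))"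

definition efunctor_comp ::
  "('p, 'q, 'a, 't, 'r) efunctor \<Rightarrow> ('o, 'p, 'a, 's, 't) efunctor \<Rightarrow>
     ('o, 'q, 'a, 's, 'r) efunctor" where
  "efunctor_comp G F =
     \<lparr>fobj = (\<lambda>X. fobj G (fobj F X)),
      farr = (\<lambda>X Y a x. farr G (fobj F X) (fobj F Y) a (farr F X Y a x))\<rparr>"

definition efunctor_eq ::
  "('o, 'a::complete_heyting_algebra, 's) ecat \<Rightarrow> ('o, 'p, 'a, 's, 't) efunctor \<Rightarrow>
     ('o, 'p, 'a, 's, 't) efunctor \<Rightarrow> bool" where
  "efunctor_eq D F G \<longleftrightarrow>
     (\<forall>X\<in>eobjs D. fobj F X = fobj G X) \<and>
     (\<forall>X\<in>eobjs D. \<forall>Y\<in>eobjs D. \<forall>a. \<forall>x\<in>sections (ehom D X Y) a.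
        farr F X Y a x = farr G X Y a x)"

definition later_ecat ::
  "'a::complete_heyting_algebra set \<Rightarrow> ('o, 'a, 's) ecat \<Rightarrow> ('o, 'a, ('a \<times> 's) set) ecat" where
  "later_ecat K C =
     \<lparr>eobjs = eobjs C,
      ehom = (\<lambda>X Y. later K (ehom C X Y)),
      ecomp = (\<lambda>X Y Z a GH.
        later_map K (ehom C X Z) (ecomp C X Y Z) a (later_pair a GH)),
      eident = (\<lambda>X a u. next_map K (ehom C X X) a (eident C X a u))\<rparr>"

lemma enriched_categoryD:
  assumes "enriched_category C"
  shows "X \<in> eobjs C \<Longrightarrow> Y \<in> eobjs C \<Longrightarrow> sheaf (ehom C X Y)"
    and "X \<in> eobjs C \<Longrightarrow> Y \<in> eobjs C \<Longrightarrow> presheaf (ehom C X Y)"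
    and "X \<in> eobjs C \<Longrightarrow> Y \<in> eobjs C \<Longrightarrow> Z \<in> eobjs C \<Longrightarrow>
      psh_hom (prod_psh (ehom C Y Z) (ehom C X Y)) (ehom C X Z) (ecomp C X Y Z)"
    and "X \<in> eobjs C \<Longrightarrow> psh_hom one_psh (ehom C X X) (eident C X)"
    and "W \<in> eobjs C \<Longrightarrow> X \<in> eobjs C \<Longrightarrow> Y \<in> eobjs C \<Longrightarrow> Z \<in> eobjs C \<Longrightarrow>
      f \<in> sections (ehom C W X) a \<Longrightarrow> g \<in> sections (ehom C X Y) a \<Longrightarrow>
      h \<in> sections (ehom C Y Z) a \<Longrightarrow>
      ecomp C W X Z a (ecomp C X Y Z a (h, g), f) = ecomp C W Y Z a (h, ecomp C W X Y a (g, f))"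
    and "X \<in> eobjs C \<Longrightarrow> Y \<in> eobjs C \<Longrightarrow> f \<in> sections (ehom C X Y) a \<Longrightarrow>
      ecomp C X X Y a (f, eident C X a ()) = f"
    and "X \<in> eobjs C \<Longrightarrow> Y \<in> eobjs C \<Longrightarrow> f \<in> sections (ehom C X Y) a \<Longrightarrow>
      ecomp C X Y Y a (eident C Y a (), f) = f"
  using assms unfolding enriched_category_def
  by (simp_all add: sheaf_presheaf)

lemma category_externalisation:
  assumes C: "enriched_category C" shows "category (externalisation C)"
proof -
  have comp: "psh_hom one_psh (ehom C X Z) (\<lambda>a u. ecomp C X Y Z a (g a u, f a u))"
    if "X \<in> eobjs C" "Y \<in> eobjs C" "Z \<in> eobjs C"
      "psh_hom one_psh (ehom C X Y) f" "psh_hom one_psh (ehom C Y Z) g" for X Y Z f g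
    using enriched_categoryD(3)[OF C that(1-3)] that(4,5)
    unfolding psh_hom_def one_psh_def prod_psh_def by simp
  have el: "f a u \<in> sections (ehom C X Y) a" if "psh_hom one_psh (ehom C X Y) f" for X Y f a u
    using that unfolding psh_hom_def one_psh_def by simp
  show ?thesis
    unfolding category_def externalisation_def
    by (simp add: comp el enriched_categoryD(4)[OF C] enriched_categoryD(5)[OF C]
        enriched_categoryD(6,7)[OF C, where a = a for a] fun_eq_iff)
qed

lemma later_ecomp_hom:
  assumes C: "enriched_category C" and X: "X \<in> eobjs C" and Y: "Y \<in> eobjs C" and Z: "Z \<in> eobjs C"
  shows "psh_hom (prod_psh (later K (ehom C Y Z)) (later K (ehom C X Y))) (later K (ehom C X Z))
    (ecomp (later_ecat K C) X Y Z)"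
proof -
  note P = enriched_categoryD(2)[OF C]
  note p = later_pair_hom[OF P[OF Y Z] P[OF X Y], of K]
  note m = later_map_hom[OF presheaf_prod[OF P[OF Y Z] P[OF X Y]] P[OF X Z]
      enriched_categoryD(3)[OF C X Y Z], of K]
  show ?thesis
    using p m unfolding psh_hom_def later_ecat_def by simp
qed

lemma later_ecomp_mem:
  assumes C: "enriched_category C" and X: "X \<in> eobjs C" and Y: "Y \<in> eobjs C" and Z: "Z \<in> eobjs C"
    and G: "germs (later_pre K (ehom C Y Z)) a G" and H: "germs (later_pre K (ehom C X Y)) a H"
    and m: "(b, g) \<in> G" "(b, f) \<in> H"
  shows "(b, ecomp C X Y Z (predecessor K b) (g, f)) \<in> ecomp (later_ecat K C) X Y Z a (G, H)"
proof -
  note P = enriched_categoryD(2)[OF C]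
  have "germs (later_pre K (prod_psh (ehom C Y Z) (ehom C X Y))) a (later_pair a (G, H))"
    unfolding later_pre_prod
    using presheaf_later_pre[OF P[OF Y Z]] presheaf_later_pre[OF P[OF X Y]] G H by (rule germs_pair)
  from sheafify_map_mem[OF presheaf_later_pre[OF P[OF X Z]]
      later_pre_hom[OF enriched_categoryD(3)[OF C X Y Z]] this, of b "(g, f)"]
  show ?thesis using m by (simp add: later_ecat_def later_map_def later_pair_def)
qed

lemma next_map_mem:
  assumes X: "presheaf X" and x: "x \<in> sections X a" and b: "b \<le> a"
  shows "(b, restr X a (predecessor K b) x) \<in> next_map K X a x"
proof -
  have "next_pre K X b (restr X a b x) \<in> sections (later_pre K X) b"
    using next_pre_hom[OF X, of K] presheaf_restr(1)[OF X x b] unfolding psh_hom_def by blast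
  then have "(b, next_pre K X b (restr X a b x)) \<in> next_map K X b (restr X a b x)"
    using next_map_eq[OF X presheaf_restr(1)[OF X x b]] unit_self by metis
  moreover have "next_map K X b (restr X a b x) = restr (later K X) a b (next_map K X a x)"
    using next_map_hom[OF X] x b unfolding psh_hom_def by blast
  ultimately have "(b, next_pre K X b (restr X a b x)) \<in> next_map K X a x"
    by (simp add: later_def sheafify_def)
  then show ?thesis
    using presheaf_restr(3)[OF X x predecessor_le b] by (simp add: next_pre_def)
qed

lemma germs_next_map:
  "presheaf X \<Longrightarrow> x \<in> sections X a \<Longrightarrow> germs (later_pre K X) a (next_map K X a x)"
  using next_map_hom[of X K] unfolding psh_hom_def by (simp add: later_def sheafify_def)

theorem enriched_later_ecat:
  assumes C: "enriched_category C" shows "enriched_category (later_ecat K C)"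
proof -
  let ?L = "later_ecat K C" and ?p = "predecessor K"
  note P = enriched_categoryD(2)[OF C]
  have [simp]: "eobjs ?L = eobjs C" "\<And>X Y. ehom ?L X Y = later K (ehom C X Y)"
    "\<And>X a u. eident ?L X a u = next_map K (ehom C X X) a (eident C X a u)"
    by (simp_all add: later_ecat_def)
  have sec: "G \<in> sections (later K (ehom C X Y)) a \<longleftrightarrow> germs (later_pre K (ehom C X Y)) a G"
    for X Y a G by (simp add: later_def sheafify_def)
  have comp: "germs (later_pre K (ehom C X Z)) a (ecomp ?L X Y Z a (G, F))"
    if "X \<in> eobjs C" "Y \<in> eobjs C" "Z \<in> eobjs C"
      "germs (later_pre K (ehom C Y Z)) a G" "germs (later_pre K (ehom C X Y)) a F" for X Y Z a G F
    using later_ecomp_hom[OF C that(1-3), of K] that(4,5)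
    unfolding psh_hom_def by (simp add: sec[symmetric] prod_psh_def)
  have idS: "eident C X a () \<in> sections (ehom C X X) a"
    and idR: "b \<le> a \<Longrightarrow> restr (ehom C X X) a b (eident C X a ()) = eident C X b ()"
    if "X \<in> eobjs C" for X a b
    using enriched_categoryD(4)[OF C that] unfolding psh_hom_def one_psh_def by auto
  have idG: "germs (later_pre K (ehom C X X)) a (eident ?L X a ())" if "X \<in> eobjs C" for X a
    using germs_next_map[OF P idS] that by simp
  have idM: "(b, eident C X (?p b) ()) \<in> eident ?L X a ()" if "X \<in> eobjs C" "b \<le> a" for X a b
    using next_map_mem[OF P[OF that(1,1)] idS[OF that(1)] that(2), of K]
      idR[OF that(1) order.trans[OF predecessor_le that(2)]] by simp
  have mem: "f \<in> sections (ehom C X Y) (?p b)"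
    if "germs (later_pre K (ehom C X Y)) a F" "(b, f) \<in> F" for X Y a b f F
    using germsD(2)[OF that] by (simp add: later_pre_def)
  have down: "\<exists>x. (d, x) \<in> F" if "germs Q a F" "d \<le> c" "\<exists>x. (c, x) \<in> F"
    for c d a F and Q :: "('b, 'c) psh" using germsD(3)[OF that(1)] that(2,3) by blast
  have "ecomp ?L W X Z a (ecomp ?L X Y Z a (H, G), F) = ecomp ?L W Y Z a (H, ecomp ?L W X Y a (G, F))"
    if o: "W \<in> eobjs C" "X \<in> eobjs C" "Y \<in> eobjs C" "Z \<in> eobjs C"
      and F: "germs (later_pre K (ehom C W X)) a F" and G: "germs (later_pre K (ehom C X Y)) a G"
      and H: "germs (later_pre K (ehom C Y Z)) a H" for W X Y Z a F G H
  proof (rule germs_eqI[OF presheaf_later_pre[OF P[OF o(1,4)]]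
        comp[OF o(1,2,4) comp[OF o(2-4) H G] F] comp[OF o(1,3,4) H comp[OF o(1-3) G F]]])
    have "locally a (\<lambda>b. (\<exists>f. (b, f) \<in> F) \<and> (\<exists>g. (b, g) \<in> G))"
      using germsD(6)[OF F] germsD(6)[OF G]
      by (rule locally_conj) (rule down[OF F], assumption+, rule down[OF G])
    then have "locally a (\<lambda>b. ((\<exists>f. (b, f) \<in> F) \<and> (\<exists>g. (b, g) \<in> G)) \<and> (\<exists>h. (b, h) \<in> H))"
      using germsD(6)[OF H]
      by (rule locally_conj) (use germsD(3)[OF F] germsD(3)[OF G] germsD(3)[OF H] in blast)+
    then show "locally a (\<lambda>b. \<exists>x. (b, x) \<in> ecomp ?L W X Z a (ecomp ?L X Y Z a (H, G), F) \<and>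
      (b, x) \<in> ecomp ?L W Y Z a (H, ecomp ?L W X Y a (G, F)))"
    proof (rule locally_mono)
      fix b assume "((\<exists>f. (b, f) \<in> F) \<and> (\<exists>g. (b, g) \<in> G)) \<and> (\<exists>h. (b, h) \<in> H)"
      then obtain f g h where m: "(b, f) \<in> F" "(b, g) \<in> G" "(b, h) \<in> H" by blast
      have 1: "(b, ecomp C W X Z (?p b) (ecomp C X Y Z (?p b) (h, g), f)) \<in>
          ecomp ?L W X Z a (ecomp ?L X Y Z a (H, G), F)"
        using later_ecomp_mem[OF C o(1,2,4) comp[OF o(2-4) H G] F
            later_ecomp_mem[OF C o(2-4) H G m(3,2)] m(1)] .
      have 2: "(b, ecomp C W Y Z (?p b) (h, ecomp C W X Y (?p b) (g, f))) \<in>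
          ecomp ?L W Y Z a (H, ecomp ?L W X Y a (G, F))"
        using later_ecomp_mem[OF C o(1,3,4) H comp[OF o(1-3) G F] m(3)
            later_ecomp_mem[OF C o(1-3) G F m(2,1)]] .
      show "\<exists>x. (b, x) \<in> ecomp ?L W X Z a (ecomp ?L X Y Z a (H, G), F) \<and>
          (b, x) \<in> ecomp ?L W Y Z a (H, ecomp ?L W X Y a (G, F))"
        using 1 2 enriched_categoryD(5)[OF C o mem[OF F m(1)] mem[OF G m(2)] mem[OF H m(3)]]
        by metis
    qed
  qed
  moreover have "ecomp ?L X X Y a (F, eident ?L X a ()) = F \<and>
      ecomp ?L X Y Y a (eident ?L Y a (), F) = F"
    if o: "X \<in> eobjs C" "Y \<in> eobjs C" and F: "germs (later_pre K (ehom C X Y)) a F" for X Y a F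
  proof
    note Q = presheaf_later_pre[OF P[OF o]]
    show "ecomp ?L X X Y a (F, eident ?L X a ()) = F"
    proof (rule germs_eqI[OF Q comp[OF o(1,1,2) F idG[OF o(1)]] F], rule locally_mono[OF germsD(6)[OF F]])
      fix b assume b: "b \<le> a" "\<exists>f. (b, f) \<in> F"
      then obtain f where f: "(b, f) \<in> F" by blast
      show "\<exists>x. (b, x) \<in> ecomp ?L X X Y a (F, eident ?L X a ()) \<and> (b, x) \<in> F"
        using later_ecomp_mem[OF C o(1,1,2) F idG[OF o(1)] f idM[OF o(1) b(1)]] f
          enriched_categoryD(6)[OF C o mem[OF F f]] by metis
    qed
    show "ecomp ?L X Y Y a (eident ?L Y a (), F) = F"
    proof (rule germs_eqI[OF Q comp[OF o(1,2,2) idG[OF o(2)] F] F], rule locally_mono[OF germsD(6)[OF F]])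
      fix b assume b: "b \<le> a" "\<exists>f. (b, f) \<in> F"
      then obtain f where f: "(b, f) \<in> F" by blast
      show "\<exists>x. (b, x) \<in> ecomp ?L X Y Y a (eident ?L Y a (), F) \<and> (b, x) \<in> F"
        using later_ecomp_mem[OF C o(1,2,2) idG[OF o(2)] F idM[OF o(2) b(1)] f] f
          enriched_categoryD(7)[OF C o mem[OF F f]] by metis
    qed
  qed
  moreover have "psh_hom one_psh (later K (ehom C X X)) (eident ?L X)" if "X \<in> eobjs C" for X
    using next_map_hom[OF P[OF that that], of K] enriched_categoryD(4)[OF C that]
    unfolding psh_hom_def one_psh_def by simp
  ultimately show ?thesis
    unfolding enriched_category_def
    using later_sheaf[OF P] later_ecomp_hom[OF C] by (simp add: sec)
qed

definition next_efunctor ::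
  "'a::complete_heyting_algebra set \<Rightarrow> ('o, 'a, 's) ecat \<Rightarrow>
     ('o, 'o, 'a, 's, ('a \<times> 's) set) efunctor" where
  "next_efunctor K C =
     \<lparr>fobj = (\<lambda>X. X), farr = (\<lambda>X Y. next_map K (ehom C X Y))\<rparr>"

theorem enriched_next_efunctor:
  assumes C: "enriched_category C"
  shows "enriched_functor C (later_ecat K C) (next_efunctor K C)"
proof -
  let ?p = "predecessor K"
  note P = enriched_categoryD(2)[OF C]
  have "next_map K (ehom C X Z) a (ecomp C X Y Z a (g, f)) =
      ecomp (later_ecat K C) X Y Z a (next_map K (ehom C Y Z) a g, next_map K (ehom C X Y) a f)"
    if o: "X \<in> eobjs C" "Y \<in> eobjs C" "Z \<in> eobjs C"
      and f: "f \<in> sections (ehom C X Y) a" and g: "g \<in> sections (ehom C Y Z) a" for X Y Z a f g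
  proof -
    note c = enriched_categoryD(3)[OF C o]
    have gf: "ecomp C X Y Z a (g, f) \<in> sections (ehom C X Z) a"
      using c f g unfolding psh_hom_def prod_psh_def by simp
    note F = germs_next_map[OF P[OF o(1,2)] f, of K] and G = germs_next_map[OF P[OF o(2,3)] g, of K]
    have GF: "germs (later_pre K (ehom C X Z)) a
        (ecomp (later_ecat K C) X Y Z a (next_map K (ehom C Y Z) a g, next_map K (ehom C X Y) a f))"
      using later_ecomp_hom[OF C o, of K] F G
      unfolding psh_hom_def by (simp add: prod_psh_def later_def sheafify_def)
    have "restr (ehom C X Z) a (?p a) (ecomp C X Y Z a (g, f)) =
        ecomp C X Y Z (?p a) (restr (ehom C Y Z) a (?p a) g, restr (ehom C X Y) a (?p a) f)"
      using c f g predecessor_le[of K a] unfolding psh_hom_def prod_psh_def by simp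
    then show ?thesis
      using later_ecomp_mem[OF C o G F next_map_mem[OF P[OF o(2,3)] g order.refl]
          next_map_mem[OF P[OF o(1,2)] f order.refl]]
        next_map_mem[OF P[OF o(1,3)] gf order.refl, of K]
      by (intro germs_eqI[OF presheaf_later_pre[OF P[OF o(1,3)]]
            germs_next_map[OF P[OF o(1,3)] gf] GF] locallyI) metis
  qed
  moreover have "psh_hom (ehom C X Y) (ehom (later_ecat K C) X Y) (next_map K (ehom C X Y))"
    if "X \<in> eobjs C" "Y \<in> eobjs C" for X Y
    using next_map_hom[OF P[OF that], of K] by (simp add: later_ecat_def)
  moreover have "eobjs (later_ecat K C) = eobjs C"
    "\<And>X a. eident (later_ecat K C) X a () = next_map K (ehom C X X) a (eident C X a ())"
    by (simp_all add: later_ecat_def)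
  ultimately show ?thesis
    unfolding enriched_functor_def next_efunctor_def by simp
qed

definition locally_contractive ::
  "'a::complete_heyting_algebra set \<Rightarrow> ('o, 'a, 's) ecat \<Rightarrow> ('p, 'a, 't) ecat \<Rightarrow>
     ('o, 'p, 'a, 's, 't) efunctor \<Rightarrow> bool" where
  "locally_contractive K D C F \<longleftrightarrow>
     (\<exists>G. enriched_functor (later_ecat K D) C G \<and>
          efunctor_eq D F (efunctor_comp G (next_efunctor K D)))"

definition contractively_complete ::
  "'a::complete_heyting_algebra set \<Rightarrow> ('o, 'a, 's) ecat \<Rightarrow> bool" where
  "contractively_complete K C \<longleftrightarrow>
     (\<forall>F. enriched_functor C C F \<and> locally_contractive K C C F
        \<longrightarrow> (\<exists>X\<in>eobjs C. isomorphic (externalisation C) (fobj F X) X))"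

end

theory Submission
  imports Defs
begin

text \<open>Contractivity turns a morphism at stage \<open>p(a)\<close> into one at stage \<open>a\<close>. By well-founded
  recursion on \<open>K\<close> put \<open>Y\<^sub>k = lim\<^bsub>j<k\<^esub> F Y\<^sub>j\<close>, and let \<open>L = lim\<^bsub>j\<in>K\<^esub> F Y\<^sub>j\<close>, with its evident
  algebra structure \<open>r : F L \<rightarrow> L\<close>. The limits are only limits for global morphisms, so
  \<open>r\<close> need not be invertible. However, \<open>L\<close> contains the fixed point as a retract: by recursion on
  \<open>k\<close> and gluing along \<open>p(k) = \<Or>{j \<in> K. j < k}\<close> one finds \<open>c\<^sub>k : Y\<^sub>k \<rightarrow> F L\<close> at stage \<open>p(k)\<close> whose
  restriction to \<open>j < k\<close> is \<open>F(r c\<^sub>j)\<close> after the projection \<open>Y\<^sub>k \<rightarrow> F Y\<^sub>j\<close>, and in the same way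
  a global \<open>c : L \<rightarrow> F L\<close>. Then \<open>c r = F(r c)\<close>, and \<open>F(r c) c = c\<close> by well-founded induction.
  Hence \<open>r c\<close> is idempotent. It splits by completeness, and \<open>c\<close> and \<open>r\<close> induce mutually inverse
  morphisms between its splitting \<open>Z\<close> and \<open>F Z\<close>.\<close>

section \<open>Limits in ordinary categories\<close>

lemma smallE:
  assumes "small TYPE('u) S"
  obtains f :: "'b \<Rightarrow> 'u" where "inj_on f S"
  using assms ordLess_imp_ordLeq[of "|S|" "|UNIV :: 'u set|"]
  unfolding small_def by (auto simp flip: card_of_ordLeq)

lemma small_image: "small U S \<Longrightarrow> small U (f ` S)"
  unfolding small_def using card_of_image ordLeq_ordLess_trans by blast

lemma small_subset: "small U T \<Longrightarrow> S \<subseteq> T \<Longrightarrow> small U S"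
  unfolding small_def using card_of_mono1 ordLeq_ordLess_trans by blast

lemma small_finite:
  fixes S :: "'b set"
  assumes "infinite (UNIV :: 'u set)" "finite S" shows "small TYPE('u) S"
proof -
  have "\<nexists>f :: 'u \<Rightarrow> 'b. inj_on f UNIV \<and> f ` UNIV \<subseteq> S"
    using assms finite_imageD finite_subset by metis
  then show ?thesis unfolding small_def card_of_ordLess .
qed

text \<open>\<open>complete_category\<close> only speaks of index categories with objects and arrows
  in \<open>'u\<close>. Injections into \<open>'u\<close> carry any other small index category to
  one of these, and a limit of the copied diagram is a limit of the original.\<close>

lemma complete_categoryD:
  fixes J :: "('i, 'm) cat" and C :: "('o, 'n) cat"
  assumes C: "complete_category TYPE('u) C" and J: "category J"
    and so: "small TYPE('u) (objs J)" and sa: "small TYPE('u) (\<Union>i\<in>objs J. \<Union>j\<in>objs J. hom J i j)"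
    and D: "is_diagram J C D"
  shows "\<exists>L p. limit_cone J C D L p"
proof -
  let ?A = "\<Union>i\<in>objs J. \<Union>j\<in>objs J. hom J i j"
  obtain f :: "'i \<Rightarrow> 'u" where f: "inj_on f (objs J)" using so by (rule smallE)
  \<comment> \<open>Injective on the union of all hom-sets, so decoding an arrow needs neither its
    source nor its target.\<close>
  obtain g :: "'m \<Rightarrow> 'u" where g: "inj_on g ?A" using sa by (rule smallE)
  define f' where "f' = the_inv_into (objs J) f"
  define g' where "g' = the_inv_into ?A g"
  have f' [simp]: "f' (f i) = i" if "i \<in> objs J" for i
    using f that by (simp add: f'_def the_inv_into_f_f)
  have g' [simp]: "g' (g u) = u" if "i \<in> objs J" "j \<in> objs J" "u \<in> hom J i j" for i j u
    unfolding g'_def using that by (intro the_inv_into_f_f[OF g]) blast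
  define J' :: "('u, 'u) cat" where
    "J' = \<lparr>objs = f ` objs J, hom = (\<lambda>i j. g ` hom J (f' i) (f' j)),
      comp = (\<lambda>i j k v u. g (comp J (f' i) (f' j) (f' k) (g' v) (g' u))),
      ident = (\<lambda>i. g (ident J (f' i)))\<rparr>"
  have J'_sel: "objs J' = f ` objs J" "\<And>i j. hom J' i j = g ` hom J (f' i) (f' j)"
    "\<And>i j k u v. comp J' i j k v u = g (comp J (f' i) (f' j) (f' k) (g' v) (g' u))"
    "\<And>i. ident J' i = g (ident J (f' i))"
    by (simp_all add: J'_def)
  define D' :: "('u, 'u, 'o, 'n) diagram" where
    "D' = \<lparr>dobj = (\<lambda>i. dobj D (f' i)), darr = (\<lambda>i j u. darr D (f' i) (f' j) (g' u))\<rparr>"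
  have D'_sel: "\<And>i. dobj D' i = dobj D (f' i)"
    "\<And>i j u. darr D' i j u = darr D (f' i) (f' j) (g' u)"
    by (simp_all add: D'_def)
  have Jc: "comp J i j k v u \<in> hom J i k"
    if "i \<in> objs J" "j \<in> objs J" "k \<in> objs J" "u \<in> hom J i j" "v \<in> hom J j k" for i j k u v
    using J that unfolding category_def by blast
  have Ji: "ident J i \<in> hom J i i" if "i \<in> objs J" for i
    using J that unfolding category_def by blast
  have "category J'"
    using J unfolding category_def by (simp add: J'_sel Jc Ji)
  moreover have "small TYPE('u) (objs J')"
    using small_image[OF so] by (simp add: J'_sel)
  moreover have "small TYPE('u) (\<Union>i\<in>objs J'. \<Union>j\<in>objs J'. hom J' i j)"
    by (rule small_subset[OF small_image[OF sa, of g]]) (auto simp: J'_sel)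
  moreover have "is_diagram J' C D'"
    using D unfolding is_diagram_def by (simp add: J'_sel D'_sel Jc Ji)
  ultimately obtain L p where L: "limit_cone J' C D' L p"
    using C unfolding complete_category_def by blast
  have cone_J': "cone J' C D' M q \<longleftrightarrow> cone J C D M (\<lambda>i. q (f i))" for M q
    unfolding cone_def by (simp add: J'_sel D'_sel)
  have cone_cong: "cone J C D M q \<longleftrightarrow> cone J C D M (\<lambda>i. q (f' (f i)))" for M q
    unfolding cone_def by simp
  have "limit_cone J C D L (\<lambda>i. p (f i))"
    unfolding limit_cone_def
  proof (intro conjI allI impI)
    show "cone J C D L (\<lambda>i. p (f i))" using L unfolding limit_cone_def cone_J' by blast
    fix M q assume "cone J C D M q"
    then have "cone J' C D' M (\<lambda>i. q (f' i))" using cone_cong[of M q] by (simp add: cone_J')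
    then have "\<exists>!h. h \<in> hom C M L \<and>
        (\<forall>i\<in>objs J'. comp C M L (dobj D' i) (p i) h = q (f' i))"
      using L unfolding limit_cone_def by blast
    then show "\<exists>!h. h \<in> hom C M L \<and> (\<forall>i\<in>objs J. comp C M L (dobj D i) (p (f i)) h = q i)"
      by (simp add: J'_sel D'_sel)
  qed
  then show ?thesis by blast
qed

text \<open>A splitting of \<open>e\<close> is a limit of the diagram on \<open>L\<close> whose only
  arrows are the identity and \<open>e\<close>: a cone is a map fixed by \<open>e\<close>, and
  \<open>e\<close> itself induces \<open>q\<close>.\<close>

lemma idempotent_splits:
  assumes inf: "infinite (UNIV :: 'u set)" and C: "category C"
    and complete: "complete_category TYPE('u) C"
    and L: "L \<in> objs C" and e: "e \<in> hom C L L" "comp C L L L e e = e"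
  obtains Z q i where "Z \<in> objs C" "q \<in> hom C L Z" "i \<in> hom C Z L"
    "comp C L Z L i q = e" "comp C Z L Z q i = ident C Z"
proof -
  \<comment> \<open>The monoid of truth values under conjunction: \<open>True\<close> stands for the
    identity, \<open>False\<close> for the idempotent.\<close>
  define J :: "(unit, bool) cat" where
    "J = \<lparr>objs = UNIV, hom = (\<lambda>_ _. UNIV), comp = (\<lambda>_ _ _. (\<and>)), ident = (\<lambda>_. True)\<rparr>"
  define D where "D = \<lparr>dobj = (\<lambda>_ :: unit. L), darr = (\<lambda>_ _ u. if u then ident C L else e)\<rparr>"
  have J: "category J" unfolding category_def J_def by auto
  have idL: "ident C L \<in> hom C L L" using C L unfolding category_def by blast
  have idL': "comp C X L L (ident C L) f = f" if "X \<in> objs C" "f \<in> hom C X L" for X f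
    using C L that unfolding category_def by blast
  have "is_diagram J C D"
    unfolding is_diagram_def J_def D_def
    using L e idL idL'[OF L] C by (auto simp: category_def)
  moreover have "small TYPE('u) (objs J)"
    "small TYPE('u) (\<Union>i\<in>objs J. \<Union>j\<in>objs J. hom J i j)"
    by (simp_all add: small_finite[OF inf])
  ultimately obtain Z p where Z: "limit_cone J C D Z p"
    using complete_categoryD[OF complete J] by blast
  have cone_iff: "cone J C D M q \<longleftrightarrow> M \<in> objs C \<and> q () \<in> hom C M L \<and> comp C M L L e (q ()) = q ()"
    for M q
    unfolding cone_def J_def D_def using idL' by (auto simp: all_bool_eq)
  have univ: "\<exists>!h. h \<in> hom C M Z \<and> comp C M Z L (p ()) h = f"
    if "M \<in> objs C" "f \<in> hom C M L" "comp C M L L e f = f" for M f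
  proof -
    have "cone J C D M (\<lambda>_. f)" using cone_iff that by blast
    then have "\<exists>!h. h \<in> hom C M Z \<and> (\<forall>i\<in>objs J. comp C M Z (dobj D i) (p i) h = f)"
      using Z unfolding limit_cone_def by blast
    then show ?thesis by (simp add: J_def D_def)
  qed
  have i: "Z \<in> objs C" "p () \<in> hom C Z L" "comp C Z L L e (p ()) = p ()"
    using Z cone_iff[of Z p] unfolding limit_cone_def by auto
  obtain q where q: "q \<in> hom C L Z" "comp C L Z L (p ()) q = e" using univ[OF L e] by blast
  \<comment> \<open>\<open>q\<close> after \<open>p ()\<close> and the identity both factor
    \<open>p ()\<close> through itself, hence agree by uniqueness.\<close>
  have "comp C Z Z L (p ()) (comp C Z L Z q (p ())) = p ()"
    using C i q L unfolding category_def by metis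
  moreover have "comp C Z Z L (p ()) (ident C Z) = p ()" "ident C Z \<in> hom C Z Z"
    "comp C Z L Z q (p ()) \<in> hom C Z Z"
    using C i q L unfolding category_def by blast+
  ultimately have "comp C Z L Z q (p ()) = ident C Z" using univ[OF i] by blast
  then show thesis using that i q by blast
qed

section \<open>Morphisms at a stage\<close>

text \<open>A section of a hom-sheaf is bundled with its stage, source and target, so that
  composition needs no index arguments and composites can be simplified by rewriting.\<close>

datatype ('o, 'a, 's) arrow = Arrow (stg: 'a) (src: 'o) (tgt: 'o) (sec: 's)

locale enriched =
  fixes C :: "('o, 'a::complete_heyting_algebra, 's) ecat"
  assumes C: "enriched_category C"
begin

definition arr :: "('o, 'a, 's) arrow \<Rightarrow> bool" where
  "arr m \<longleftrightarrow> src m \<in> eobjs C \<and> tgt m \<in> eobjs C \<and> sec m \<in> sections (ehom C (src m) (tgt m)) (stg m)"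

definition res :: "('o, 'a, 's) arrow \<Rightarrow> 'a \<Rightarrow> ('o, 'a, 's) arrow"  (infixl "\<restriction>" 70) where
  "m \<restriction> b = Arrow b (src m) (tgt m) (restr (ehom C (src m) (tgt m)) (stg m) b (sec m))"

text \<open>Stage and middle object are taken from \<open>f\<close>; the value is meaningful when
  \<open>g\<close> has that stage and starts at \<open>tgt f\<close>.\<close>

definition cmp :: "('o, 'a, 's) arrow \<Rightarrow> ('o, 'a, 's) arrow \<Rightarrow> ('o, 'a, 's) arrow"
  (infixr "\<cdot>" 65) where
  "g \<cdot> f = Arrow (stg f) (src f) (tgt g) (ecomp C (src f) (tgt f) (tgt g) (stg f) (sec g, sec f))"

definition idn :: "'a \<Rightarrow> 'o \<Rightarrow> ('o, 'a, 's) arrow" where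
  "idn a X = Arrow a X X (eident C X a ())"

lemma arrow_sel [simp]:
  "stg (m \<restriction> b) = b" "src (m \<restriction> b) = src m" "tgt (m \<restriction> b) = tgt m"
  "stg (g \<cdot> f) = stg f" "src (g \<cdot> f) = src f" "tgt (g \<cdot> f) = tgt g"
  "stg (idn a X) = a" "src (idn a X) = X" "tgt (idn a X) = X"
  by (simp_all add: res_def cmp_def idn_def)

lemma arr_res [simp]: "arr m \<Longrightarrow> b \<le> stg m \<Longrightarrow> arr (m \<restriction> b)"
  using presheaf_restr(1)[OF enriched_categoryD(2)[OF C]] by (simp add: arr_def res_def)

lemma res_res [simp]: "arr m \<Longrightarrow> c \<le> b \<Longrightarrow> b \<le> stg m \<Longrightarrow> m \<restriction> b \<restriction> c = m \<restriction> c"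
  using presheaf_restr(3)[OF enriched_categoryD(2)[OF C]] by (simp add: arr_def res_def)

lemma res_self: "arr m \<Longrightarrow> stg m = a \<Longrightarrow> m \<restriction> a = m"
  using presheaf_restr(2)[OF enriched_categoryD(2)[OF C]] by (cases m) (auto simp: arr_def res_def)

lemma arr_cmp [simp]: "arr g \<Longrightarrow> arr f \<Longrightarrow> stg g = stg f \<Longrightarrow> tgt f = src g \<Longrightarrow> arr (g \<cdot> f)"
  using enriched_categoryD(3)[OF C, of "src f" "tgt f" "tgt g"]
  by (simp add: arr_def cmp_def psh_hom_def prod_psh_def)

lemma res_cmp [simp]:
  "arr g \<Longrightarrow> arr f \<Longrightarrow> stg g = stg f \<Longrightarrow> tgt f = src g \<Longrightarrow> b \<le> stg f \<Longrightarrow>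
    (g \<cdot> f) \<restriction> b = g \<restriction> b \<cdot> f \<restriction> b"
  using enriched_categoryD(3)[OF C, of "src f" "tgt f" "tgt g"]
  by (simp add: arr_def cmp_def res_def psh_hom_def prod_psh_def)

lemma cmp_assoc [simp]:
  "arr h \<Longrightarrow> arr g \<Longrightarrow> arr f \<Longrightarrow> stg h = stg g \<Longrightarrow> stg g = stg f \<Longrightarrow> tgt g = src h \<Longrightarrow> tgt f = src g \<Longrightarrow>
    (h \<cdot> g) \<cdot> f = h \<cdot> g \<cdot> f"
  using enriched_categoryD(5)[OF C, of "src f" "tgt f" "tgt g" "tgt h" "sec f" "stg f"]
  by (simp add: arr_def cmp_def)

lemma arr_idn [simp]: "X \<in> eobjs C \<Longrightarrow> arr (idn a X)"
  using enriched_categoryD(4)[OF C] by (simp add: arr_def idn_def psh_hom_def one_psh_def)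

lemma res_idn [simp]: "X \<in> eobjs C \<Longrightarrow> b \<le> a \<Longrightarrow> idn a X \<restriction> b = idn b X"
  using enriched_categoryD(4)[OF C, of X] by (simp add: idn_def res_def psh_hom_def one_psh_def)

lemma cmp_idn [simp]:
  "arr f \<Longrightarrow> stg f = a \<Longrightarrow> src f = X \<Longrightarrow> f \<cdot> idn a X = f"
  "arr f \<Longrightarrow> stg f = a \<Longrightarrow> tgt f = X \<Longrightarrow> idn a X \<cdot> f = f"
  using enriched_categoryD(6,7)[OF C] by (cases f; auto simp: arr_def cmp_def idn_def)+

text \<open>The hom-sheaf is separated, and \<open>S\<close> covers the common stage.\<close>

lemma arr_eqI:
  assumes "arr m" "arr n" "src m = src n" "tgt m = tgt n" "stg m = Sup S" "stg n = Sup S"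
    and eq: "\<And>k. k \<in> S \<Longrightarrow> m \<restriction> k = n \<restriction> k"
  shows "m = n"
proof -
  have "locally (Sup S) (\<lambda>k. m \<restriction> k = n \<restriction> k)"
    by (rule locally_Sup, rule locallyI, rule eq)
  then have "locally (Sup S) (\<lambda>k. restr (ehom C (src n) (tgt n)) (Sup S) k (sec m) =
      restr (ehom C (src n) (tgt n)) (Sup S) k (sec n))"
    using assms(3-6) by (simp add: res_def)
  then have "sec m = sec n"
    using assms(1-6) by (intro sheaf_separated[OF enriched_categoryD(1)[OF C]]) (auto simp: arr_def)
  then show ?thesis using assms(3-6) by (simp add: arrow.expand)
qed

text \<open>Agreement on comparable indices suffices. The meet of two indices is covered by basis
  elements, which lie in \<open>S\<close> because \<open>S\<close> is closed downwards in
  \<open>K\<close>, so the family matches on the meet.\<close>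

lemma glue:
  assumes K: "basis K" and S: "S \<subseteq> K" "\<And>j k. j \<in> S \<Longrightarrow> k \<in> K \<Longrightarrow> k \<le> j \<Longrightarrow> k \<in> S"
    and obj: "X \<in> eobjs C" "Y \<in> eobjs C"
    and m: "\<And>j. j \<in> S \<Longrightarrow> arr (m j)" "\<And>j. j \<in> S \<Longrightarrow> stg (m j) = j"
      "\<And>j. j \<in> S \<Longrightarrow> src (m j) = X" "\<And>j. j \<in> S \<Longrightarrow> tgt (m j) = Y"
    and eq: "\<And>i j. j \<in> S \<Longrightarrow> i \<in> S \<Longrightarrow> i \<le> j \<Longrightarrow> m j \<restriction> i = m i"
  obtains n where "arr n" "stg n = Sup S" "src n = X" "tgt n = Y" "\<And>j. j \<in> S \<Longrightarrow> n \<restriction> j = m j"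
proof -
  have "m i \<restriction> inf i j = m j \<restriction> inf i j" if "i \<in> S" "j \<in> S" for i j
  proof (rule arr_eqI[where S = "{k \<in> K. k \<le> inf i j}"])
    have Sup: "Sup {k \<in> K. k \<le> inf i j} = inf i j"
      using K unfolding basis_def by metis
    then show "stg (m i \<restriction> inf i j) = Sup {k \<in> K. k \<le> inf i j}"
      "stg (m j \<restriction> inf i j) = Sup {k \<in> K. k \<le> inf i j}" by simp_all
    fix k assume k: "k \<in> {k \<in> K. k \<le> inf i j}"
    then have "k \<in> S" using S(2) that by auto
    then show "m i \<restriction> inf i j \<restriction> k = m j \<restriction> inf i j \<restriction> k"
      using k that m eq by simp
  qed (use m that in simp_all)
  then have "restr (ehom C X Y) i (inf i j) (sec (m i)) = restr (ehom C X Y) j (inf i j) (sec (m j))"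
    if "i \<in> S" "j \<in> S" for i j
    using that m(2-4) by (simp add: res_def)
  moreover have "sec (m j) \<in> sections (ehom C X Y) j" if "j \<in> S" for j
    using m that by (simp add: arr_def)
  ultimately have "matching (ehom C X Y) S (\<lambda>j. sec (m j))"
    unfolding matching_def by blast
  then obtain y where y: "y \<in> sections (ehom C X Y) (Sup S)"
    "\<And>j. j \<in> S \<Longrightarrow> restr (ehom C X Y) (Sup S) j y = sec (m j)"
    using enriched_categoryD(1)[OF C obj] unfolding sheaf_def by blast
  show thesis
    using that[of "Arrow (Sup S) X Y y"] y obj m
    by (simp add: arr_def res_def arrow.expand)
qed

section \<open>The ordinary category of global morphisms\<close>

definition garr :: "'o \<Rightarrow> 'o \<Rightarrow> ('o, 'a, 's) arrow set" where
  "garr X Y = {m. arr m \<and> stg m = top \<and> src m = X \<and> tgt m = Y}"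

definition globals :: "('o, ('o, 'a, 's) arrow) cat" where
  "globals = \<lparr>objs = eobjs C, hom = garr, comp = (\<lambda>_ _ _. cmp), ident = idn top\<rparr>"

lemma globals_sel [simp]:
  "objs globals = eobjs C" "hom globals = garr" "comp globals X Y Z = cmp" "ident globals = idn top"
  by (simp_all add: globals_def)

lemma garrD:
  assumes "m \<in> garr X Y" shows "arr m" "stg m = top" "src m = X" "tgt m = Y"
  using assms by (simp_all add: garr_def)

lemma garr_cmp: "g \<in> garr Y Z \<Longrightarrow> f \<in> garr X Y \<Longrightarrow> g \<cdot> f \<in> garr X Z"
  by (auto simp: garr_def)

lemma category_globals: "category globals"
  unfolding category_def by (auto simp: garr_def)

text \<open>The global element with value \<open>m\<close> at \<open>top\<close>; naturality forces
  its other values to be restrictions. This links \<open>globals\<close> to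
  \<open>externalisation C\<close>.\<close>

definition glob :: "('o, 'a, 's) arrow \<Rightarrow> 'a \<Rightarrow> unit \<Rightarrow> 's" where
  "glob m a u = sec (m \<restriction> a)"

lemma glob_hom:
  assumes "m \<in> garr X Y" shows "glob m \<in> hom (externalisation C) X Y"
proof -
  have "sec (m \<restriction> a) \<in> sections (ehom C X Y) a" for a
  proof -
    have "arr (m \<restriction> a)" "src m = X" "tgt m = Y" using assms by (simp_all add: garr_def)
    then show ?thesis by (simp add: arr_def)
  qed
  moreover have "sec (m \<restriction> b) = restr (ehom C X Y) a b (sec (m \<restriction> a))" if "b \<le> a" for a b
  proof -
    have "sec (m \<restriction> b) = sec (m \<restriction> a \<restriction> b)" using assms that by (simp add: garr_def)
    also have "\<dots> = restr (ehom C X Y) a b (sec (m \<restriction> a))"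
      using assms by (simp add: garr_def res_def)
    finally show ?thesis .
  qed
  ultimately show ?thesis
    by (simp add: externalisation_def psh_hom_def one_psh_def glob_def)
qed

lemma glob_cmp:
  "g \<in> garr Y Z \<Longrightarrow> f \<in> garr X Y \<Longrightarrow> glob (g \<cdot> f) = comp (externalisation C) X Y Z (glob g) (glob f)"
  by (auto simp: garr_def externalisation_def glob_def fun_eq_iff) (simp add: cmp_def)

lemma glob_idn: "X \<in> eobjs C \<Longrightarrow> glob (idn top X) = ident (externalisation C) X"
  by (auto simp: glob_def externalisation_def fun_eq_iff) (simp add: idn_def)

lemma glob_inj:
  assumes "m \<in> garr X Y" "n \<in> garr X Y" shows "glob m = glob n \<longleftrightarrow> m = n"
proof
  assume "glob m = glob n"
  then have "sec (m \<restriction> top) = sec (n \<restriction> top)" by (metis glob_def)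
  then show "m = n"
    using assms res_self[of m top] res_self[of n top] by (simp add: garr_def arrow.expand)
qed simp

lemma glob_surj:
  assumes X: "X \<in> eobjs C" "Y \<in> eobjs C" and f: "f \<in> hom (externalisation C) X Y"
  obtains m where "m \<in> garr X Y" "glob m = f"
proof
  show "Arrow top X Y (f top ()) \<in> garr X Y"
    using X f unfolding externalisation_def psh_hom_def one_psh_def by (simp add: garr_def arr_def)
  have "restr (ehom C X Y) top a (f top ()) = f a ()" for a
    using f unfolding externalisation_def psh_hom_def one_psh_def
    by (metis (mono_tags, lifting) UNIV_I cat.select_convs(2) mem_Collect_eq psh.select_convs top_greatest)
  then show "glob (Arrow top X Y (f top ())) = f" by (simp add: glob_def res_def fun_eq_iff)
qed

text \<open>\<open>glob\<close> is functorial and bijective on hom-sets, so diagrams, cones and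
  unique factorisations pass between the two categories.\<close>

lemma complete_globals:
  assumes "complete_category TYPE('u) (externalisation C)"
  shows "complete_category TYPE('u) globals"
  unfolding complete_category_def
proof (intro allI impI, elim conjE)
  fix J :: "('u, 'u) cat" and D :: "('u, 'u, 'o, ('o, 'a, 's) arrow) diagram"
  assume J: "category J" "small TYPE('u) (objs J)"
      "small TYPE('u) (\<Union>i\<in>objs J. \<Union>j\<in>objs J. hom J i j)"
    and D: "is_diagram J globals D"
  let ?E = "externalisation C"
  define D' where "D' = \<lparr>dobj = dobj D, darr = (\<lambda>i j u. glob (darr D i j u))\<rparr>"
  have [simp]: "dobj D' = dobj D" "darr D' i j u = glob (darr D i j u)" for i j u
    by (simp_all add: D'_def)
  have [simp]: "objs ?E = eobjs C" by (simp add: externalisation_def)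
  have Do: "dobj D i \<in> eobjs C" if "i \<in> objs J" for i
    using D that by (simp add: is_diagram_def)
  have Da: "darr D i j u \<in> garr (dobj D i) (dobj D j)"
    if "i \<in> objs J" "j \<in> objs J" "u \<in> hom J i j" for i j u
    using D that by (simp add: is_diagram_def)
  have "is_diagram J ?E D'"
    using D glob_cmp[OF Da Da] by (simp add: is_diagram_def Do Da glob_hom glob_idn)
  then obtain L p where L: "limit_cone J ?E D' L p"
    using assms J unfolding complete_category_def by blast
  have cone_iff: "cone J ?E D' M (\<lambda>i. glob (q i)) \<longleftrightarrow> cone J globals D M q"
    if "M \<in> eobjs C" "\<And>i. i \<in> objs J \<Longrightarrow> q i \<in> garr M (dobj D i)" for M q
    using that glob_cmp[OF Da that(2)] glob_inj[OF garr_cmp[OF Da that(2)] that(2)]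
    by (simp add: cone_def glob_hom)
  have Lo: "L \<in> eobjs C" using L by (simp add: limit_cone_def cone_def)
  have "\<exists>m. m \<in> garr L (dobj D i) \<and> glob m = p i" if "i \<in> objs J" for i
    using glob_surj[OF Lo Do[OF that], of "p i"] L that unfolding limit_cone_def cone_def
    by (metis \<open>dobj D' = dobj D\<close>)
  then obtain p' where p': "\<And>i. i \<in> objs J \<Longrightarrow> p' i \<in> garr L (dobj D i)"
    "\<And>i. i \<in> objs J \<Longrightarrow> glob (p' i) = p i" by metis
  have "limit_cone J globals D L p'"
    unfolding limit_cone_def
  proof (intro conjI allI impI)
    have "cone J ?E D' L (\<lambda>i. glob (p' i))"
      using L p' by (simp add: limit_cone_def cone_def)
    then show "cone J globals D L p'" using cone_iff Lo p'(1) by blast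
    fix M q assume M: "cone J globals D M q"
    then have Mo: "M \<in> eobjs C" and q: "\<And>i. i \<in> objs J \<Longrightarrow> q i \<in> garr M (dobj D i)"
      by (simp_all add: cone_def)
    have "cone J ?E D' M (\<lambda>i. glob (q i))" using cone_iff[OF Mo q] M by blast
    then have "\<exists>!h. h \<in> hom ?E M L \<and>
        (\<forall>i\<in>objs J. comp ?E M L (dobj D i) (p i) h = glob (q i))"
      using L unfolding limit_cone_def by simp
    moreover have "comp ?E M L (dobj D i) (p i) (glob h) = glob (q i) \<longleftrightarrow> p' i \<cdot> h = q i"
      if "i \<in> objs J" "h \<in> garr M L" for i h
      using glob_cmp[OF p'(1) that(2)] glob_inj[OF garr_cmp[OF p'(1) that(2)] q] p'(2) that(1)
      by simp
    ultimately show "\<exists>!h. h \<in> hom globals M L \<and>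
        (\<forall>i\<in>objs J. comp globals M L (dobj D i) (p' i) h = q i)"
      using glob_surj[OF Mo Lo] glob_hom[of _ M L] glob_inj[of _ M L]
      by (simp, smt (verit, best))
  qed
  then show "\<exists>L p. limit_cone J globals D L p" by blast
qed

lemma isomorphic_globals: "isomorphic globals X Y \<Longrightarrow> X \<in> eobjs C \<Longrightarrow> Y \<in> eobjs C \<Longrightarrow>
    isomorphic (externalisation C) X Y"
  unfolding isomorphic_def using glob_hom glob_cmp glob_idn by (simp, metis)

end

section \<open>Lifting along a locally contractive functor\<close>

text \<open>\<open>G\<close> is the second factor of the contractive functor F, after
  \<open>next\<close>. The two agree on objects, so a fixed point of \<open>fobj G\<close> is
  sought.\<close>

locale contractive = enriched C
  for C :: "('o, 'a::complete_heyting_algebra, 's) ecat" +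
  fixes K :: "'a set" and G :: "('o, 'o, 'a, ('a \<times> 's) set, 's) efunctor"
  assumes K: "well_founded_basis K"
    and G: "enriched_functor (later_ecat K C) C G"
begin

abbreviation pred :: "'a \<Rightarrow> 'a" where "pred \<equiv> predecessor K"

lemma basis_K: "basis K"
  using K by (simp add: well_founded_basis_def)

lemma Sup_K: "Sup K = top"
  using basis_K unfolding basis_def by (metis (no_types, lifting) Collect_mem_eq Collect_cong top_greatest)

lemma wf_K: "wf {(j, k). j \<in> K \<and> k \<in> K \<and> j < k}"
  using K unfolding wf_iff_no_infinite_down_chain well_founded_basis_def by blast

lemma obj_G [simp]: "X \<in> eobjs C \<Longrightarrow> fobj G X \<in> eobjs C"
  using G by (simp add: enriched_functor_def later_ecat_def)

text \<open>The image under the contractive functor \<open>F\<close> of a morphism given only at the predecessor of \<open>a\<close>.\<close>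

definition lft :: "'a \<Rightarrow> ('o, 'a, 's) arrow \<Rightarrow> ('o, 'a, 's) arrow" where
  "lft a m = Arrow a (fobj G (src m)) (fobj G (tgt m)) (farr G (src m) (tgt m) a
     (sheafify_unit (later_pre K (ehom C (src m) (tgt m))) a (sec m)))"

lemma lft_sel [simp]:
  "stg (lft a m) = a" "src (lft a m) = fobj G (src m)" "tgt (lft a m) = fobj G (tgt m)"
  by (simp_all add: lft_def)

lemma farr_hom:
  "X \<in> eobjs C \<Longrightarrow> Y \<in> eobjs C \<Longrightarrow>
    psh_hom (later K (ehom C X Y)) (ehom C (fobj G X) (fobj G Y)) (farr G X Y)"
  using G by (simp add: enriched_functor_def later_ecat_def)

lemma unit_hom:
  "X \<in> eobjs C \<Longrightarrow> Y \<in> eobjs C \<Longrightarrow>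
    psh_hom (later_pre K (ehom C X Y)) (later K (ehom C X Y)) (sheafify_unit (later_pre K (ehom C X Y)))"
  unfolding later_def
  by (intro sheafify_unit_hom presheaf_later_pre enriched_categoryD(2)[OF C])

lemma sections_later_pre: "sections (later_pre K X) a = sections X (pred a)"
  by (simp add: later_pre_def)

lemma arr_lft [simp]: "arr m \<Longrightarrow> stg m = pred a \<Longrightarrow> arr (lft a m)"
  using farr_hom[of "src m" "tgt m"] unit_hom[of "src m" "tgt m"]
  by (simp add: arr_def lft_def psh_hom_def sections_later_pre)

text \<open>Naturality of the unit and of \<open>farr G\<close>; restricting in
  \<open>later_pre\<close> from \<open>a\<close> to \<open>b\<close> means restricting from
  \<open>pred a\<close> to \<open>pred b\<close>.\<close>

lemma res_lft [simp]:
  assumes "arr m" "stg m = pred a" "b \<le> a"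
  shows "lft a m \<restriction> b = lft b (m \<restriction> pred b)"
proof -
  let ?X = "ehom C (src m) (tgt m)"
  have m: "src m \<in> eobjs C" "tgt m \<in> eobjs C" "sec m \<in> sections (later_pre K ?X) a"
    using assms by (simp_all add: arr_def sections_later_pre)
  have "sheafify_unit (later_pre K ?X) b (restr (later_pre K ?X) a b (sec m)) =
      restr (later K ?X) a b (sheafify_unit (later_pre K ?X) a (sec m))"
    using unit_hom[OF m(1,2)] m(3) assms(3) unfolding psh_hom_def by blast
  moreover have "sheafify_unit (later_pre K ?X) a (sec m) \<in> sections (later K ?X) a"
    using unit_hom[OF m(1,2)] m(3) unfolding psh_hom_def by blast
  then have "farr G (src m) (tgt m) b (restr (later K ?X) a b (sheafify_unit (later_pre K ?X) a (sec m))) =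
      restr (ehom C (fobj G (src m)) (fobj G (tgt m))) a b
        (farr G (src m) (tgt m) a (sheafify_unit (later_pre K ?X) a (sec m)))"
    using farr_hom[OF m(1,2)] assms(3) unfolding psh_hom_def by blast
  ultimately show ?thesis
    using assms(2) by (simp add: res_def lft_def later_pre_def)
qed

text \<open>Sections of the associated sheaf that share a representative at stage \<open>a\<close>
  are equal, and the composite of the two units contains the composite of the representatives.
  Functoriality of \<open>G\<close> then applies.\<close>

lemma lft_cmp [simp]:
  assumes g: "arr g" "stg g = pred a" and f: "arr f" "stg f = pred a" and gf: "tgt f = src g"
  shows "lft a (g \<cdot> f) = lft a g \<cdot> lft a f"
proof -
  let ?X = "src f" and ?Y = "src g" and ?Z = "tgt g"
  let ?u = "\<lambda>X Y. sheafify_unit (later_pre K (ehom C X Y)) a"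
  have o: "?X \<in> eobjs C" "?Y \<in> eobjs C" "?Z \<in> eobjs C"
    and fs: "sec f \<in> sections (later_pre K (ehom C ?X ?Y)) a"
    and gs: "sec g \<in> sections (later_pre K (ehom C ?Y ?Z)) a"
    and gfs: "ecomp C ?X ?Y ?Z (pred a) (sec g, sec f) \<in> sections (later_pre K (ehom C ?X ?Z)) a"
    using assms arr_cmp[of g f] by (simp_all add: arr_def sections_later_pre cmp_def)
  note Q = presheaf_later_pre[OF enriched_categoryD(2)[OF C]]
  note uf = germs_unit[OF Q[OF o(1,2)] fs] and ug = germs_unit[OF Q[OF o(2,3)] gs]
  have "germs (later_pre K (ehom C ?X ?Z)) a
      (ecomp (later_ecat K C) ?X ?Y ?Z a (?u ?Y ?Z (sec g), ?u ?X ?Y (sec f)))"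
    using later_ecomp_hom[OF C o, of K] uf ug
    by (simp add: psh_hom_def prod_psh_def later_def sheafify_def)
  then have "?u ?X ?Z (ecomp C ?X ?Y ?Z (pred a) (sec g, sec f)) =
      ecomp (later_ecat K C) ?X ?Y ?Z a (?u ?Y ?Z (sec g), ?u ?X ?Y (sec f))"
    using germs_eqI[OF Q[OF o(1,3)] germs_unit[OF Q[OF o(1,3)] gfs] _ locallyI]
      unit_self[OF gfs] later_ecomp_mem[OF C o ug uf unit_self[OF gs] unit_self[OF fs]] by blast
  moreover have "?u ?Y ?Z (sec g) \<in> sections (later K (ehom C ?Y ?Z)) a"
    "?u ?X ?Y (sec f) \<in> sections (later K (ehom C ?X ?Y)) a"
    using uf ug by (simp_all add: later_def sheafify_def)
  then have "farr G ?X ?Z a (ecomp (later_ecat K C) ?X ?Y ?Z a (?u ?Y ?Z (sec g), ?u ?X ?Y (sec f))) =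
      ecomp C (fobj G ?X) (fobj G ?Y) (fobj G ?Z) a
        (farr G ?Y ?Z a (?u ?Y ?Z (sec g)), farr G ?X ?Y a (?u ?X ?Y (sec f)))"
    using G o unfolding enriched_functor_def by (simp add: later_ecat_def)
  ultimately show ?thesis using f(2) gf by (simp add: lft_def cmp_def)
qed

text \<open>The identity of the later category is \<open>next\<close> of the identity, that is, the
  unit at its restriction to \<open>pred a\<close>.\<close>

lemma lft_idn [simp]:
  assumes X: "X \<in> eobjs C" shows "lft a (idn (pred a) X) = idn a (fobj G X)"
proof -
  have i: "eident C X a () \<in> sections (ehom C X X) a"
    "restr (ehom C X X) a (pred a) (eident C X a ()) = eident C X (pred a) ()"
    using arr_idn[OF X, of a] res_idn[OF X predecessor_le[of K a]]
    by (simp_all add: arr_def idn_def res_def)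
  have "farr G X X a (next_map K (ehom C X X) a (eident C X a ())) = eident C (fobj G X) a ()"
    using G X by (simp add: enriched_functor_def later_ecat_def)
  then show ?thesis
    using next_map_eq[OF enriched_categoryD(2)[OF C X X] i(1), where K = K] i(2)
    by (simp add: lft_def idn_def next_pre_def)
qed

text \<open>The action of \<open>F\<close> itself on global morphisms.\<close>

definition gmap :: "('o, 'a, 's) arrow \<Rightarrow> ('o, 'a, 's) arrow" where
  "gmap m = lft top (m \<restriction> pred top)"

lemma gmap_garr [simp]: "m \<in> garr X Y \<Longrightarrow> gmap m \<in> garr (fobj G X) (fobj G Y)"
  by (auto simp: gmap_def garr_def)

lemma gmap_cmp: "g \<in> garr Y Z \<Longrightarrow> f \<in> garr X Y \<Longrightarrow> gmap (g \<cdot> f) = gmap g \<cdot> gmap f"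
  by (auto simp: gmap_def garr_def)

lemma gmap_idn: "X \<in> eobjs C \<Longrightarrow> gmap (idn top X) = idn top (fobj G X)"
  by (simp add: gmap_def)

lemma res_gmap: "m \<in> garr X Y \<Longrightarrow> gmap m \<restriction> a = lft a (m \<restriction> pred a)"
  by (auto simp: gmap_def garr_def predecessor_mono)

section \<open>The tower of limits\<close>

text \<open>Arrows run from larger to smaller indices, so a diagram on \<open>down S\<close> is an
  inverse system.\<close>

definition down :: "'a set \<Rightarrow> ('a, unit) cat" where
  "down S = \<lparr>objs = S, hom = (\<lambda>j i. if i \<le> j then {()} else {}), comp = (\<lambda>_ _ _ _ _. ()),
     ident = (\<lambda>_. ())\<rparr>"

definition is_lim ::
  "'a set \<Rightarrow> ('a \<Rightarrow> 'o) \<Rightarrow> ('a \<Rightarrow> 'a \<Rightarrow> ('o, 'a, 's) arrow) \<Rightarrow> 'o \<Rightarrow> ('a \<Rightarrow> ('o, 'a, 's) arrow) \<Rightarrow> bool"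
  where "is_lim S D d = limit_cone (down S) globals \<lparr>dobj = D, darr = (\<lambda>j i _. d j i)\<rparr>"

lemma cone_down:
  "cone (down S) globals \<lparr>dobj = D, darr = (\<lambda>j i _. d j i)\<rparr> M q \<longleftrightarrow>
    M \<in> eobjs C \<and> (\<forall>j\<in>S. q j \<in> garr M (D j)) \<and> (\<forall>j\<in>S. \<forall>i\<in>S. i \<le> j \<longrightarrow> d j i \<cdot> q j = q i)"
  by (auto simp: cone_def down_def)

lemma is_lim_iff:
  "is_lim S D d L p \<longleftrightarrow>
    (L \<in> eobjs C \<and> (\<forall>j\<in>S. p j \<in> garr L (D j)) \<and> (\<forall>j\<in>S. \<forall>i\<in>S. i \<le> j \<longrightarrow> d j i \<cdot> p j = p i)) \<and>
    (\<forall>M q. M \<in> eobjs C \<and> (\<forall>j\<in>S. q j \<in> garr M (D j)) \<and>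
        (\<forall>j\<in>S. \<forall>i\<in>S. i \<le> j \<longrightarrow> d j i \<cdot> q j = q i) \<longrightarrow>
      (\<exists>!h. h \<in> garr M L \<and> (\<forall>j\<in>S. p j \<cdot> h = q j)))"
  unfolding is_lim_def limit_cone_def cone_down by (simp add: down_def)

lemma is_lim_cong:
  assumes "\<And>j. j \<in> S \<Longrightarrow> D j = D' j" "\<And>i j. i \<in> S \<Longrightarrow> j \<in> S \<Longrightarrow> d j i = d' j i"
  shows "is_lim S D d L p \<longleftrightarrow> is_lim S D' d' L p"
  unfolding is_lim_iff by (simp add: assms cong: ball_cong)

text \<open>The index objects form a subset of the small type \<open>'a\<close>; the arrows lie in
  \<open>unit\<close>, and finite sets are small because \<open>'u\<close> is infinite.\<close>

lemma is_lim_ex: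
  assumes inf: "infinite (UNIV :: 'u set)" and small: "small TYPE('u) (UNIV :: 'a set)"
    and complete: "complete_category TYPE('u) (externalisation C)"
    and D: "\<And>j. j \<in> S \<Longrightarrow> D j \<in> eobjs C"
    and d: "\<And>i j. i \<in> S \<Longrightarrow> j \<in> S \<Longrightarrow> i \<le> j \<Longrightarrow> d j i \<in> garr (D j) (D i)"
      "\<And>j. j \<in> S \<Longrightarrow> d j j = idn top (D j)"
      "\<And>i j k. i \<in> S \<Longrightarrow> j \<in> S \<Longrightarrow> k \<in> S \<Longrightarrow> i \<le> j \<Longrightarrow> j \<le> k \<Longrightarrow> d j i \<cdot> d k j = d k i"
  shows "\<exists>L p. is_lim S D d L p"
  unfolding is_lim_def
proof (rule complete_categoryD[OF complete_globals[OF complete]])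
  show "category (down S)"
    unfolding category_def down_def by auto
  show "small TYPE('u) (objs (down S))"
    by (rule small_subset[OF small]) simp
  show "small TYPE('u) (\<Union>i\<in>objs (down S). \<Union>j\<in>objs (down S). hom (down S) i j)"
    by (rule small_finite[OF inf]) simp
  show "is_diagram (down S) globals \<lparr>dobj = D, darr = (\<lambda>j i _. d j i)\<rparr>"
    using D d by (auto simp: is_diagram_def down_def)
qed

section \<open>Nodes of the tower and the comparison maps between them\<close>

definition below :: "'a \<Rightarrow> 'a set" where
  "below k = {j \<in> K. j < k}"

lemma Sup_below: "Sup (below k) = pred k"
  by (simp add: below_def predecessor_def)

lemma below_mono: "j \<le> k \<Longrightarrow> below j \<subseteq> below k"
  by (auto simp: below_def)

definition factor ::
  "'o \<times> ('a \<Rightarrow> ('o, 'a, 's) arrow) \<Rightarrow> 'o \<times> ('a \<Rightarrow> ('o, 'a, 's) arrow) \<Rightarrow> 'a set \<Rightarrow> ('o, 'a, 's) arrow"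
  where "factor N N' T = (THE h. h \<in> garr (fst N) (fst N') \<and> (\<forall>j\<in>T. snd N' j \<cdot> h = snd N j))"

text \<open>A node consists of a limit object and its projections. The tower \<open>f\<close> sends \<open>k\<close> to the
  node of \<open>Y\<^sub>k\<close>. In \<open>factor N N' T\<close> the node \<open>N'\<close> is a limit over \<open>T\<close>; it is junk unless \<open>N\<close>
  carries a cone over \<open>T\<close>.\<close>

definition node ::
  "('a \<Rightarrow> 'o \<times> ('a \<Rightarrow> ('o, 'a, 's) arrow)) \<Rightarrow> 'a set \<Rightarrow> 'o \<times> ('a \<Rightarrow> ('o, 'a, 's) arrow) \<Rightarrow> bool"
  where "node f T N \<longleftrightarrow> is_lim T (\<lambda>j. fobj G (fst (f j)))
    (\<lambda>j i. gmap (factor (f j) (f i) (below i))) (fst N) (snd N)"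

lemma nodeD:
  assumes "node f T N"
  shows "fst N \<in> eobjs C" "j \<in> T \<Longrightarrow> snd N j \<in> garr (fst N) (fobj G (fst (f j)))"
    "i \<in> T \<Longrightarrow> j \<in> T \<Longrightarrow> i \<le> j \<Longrightarrow> gmap (factor (f j) (f i) (below i)) \<cdot> snd N j = snd N i"
    "M \<in> eobjs C \<Longrightarrow> (\<And>j. j \<in> T \<Longrightarrow> q j \<in> garr M (fobj G (fst (f j)))) \<Longrightarrow>
      (\<And>i j. i \<in> T \<Longrightarrow> j \<in> T \<Longrightarrow> i \<le> j \<Longrightarrow> gmap (factor (f j) (f i) (below i)) \<cdot> q j = q i) \<Longrightarrow>
      \<exists>!h. h \<in> garr M (fst N) \<and> (\<forall>j\<in>T. snd N j \<cdot> h = q j)"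
  using assms unfolding node_def is_lim_iff by auto

text \<open>The projections of \<open>N\<close> restrict to a cone over the smaller index set
  \<open>T'\<close>.\<close>

lemma factor_ex1:
  assumes N: "node f T N" and N': "node f T' N'" and T: "T' \<subseteq> T"
  shows "\<exists>!h. h \<in> garr (fst N) (fst N') \<and> (\<forall>j\<in>T'. snd N' j \<cdot> h = snd N j)"
  using T by (intro nodeD(4)[OF N'] nodeD(1)[OF N] nodeD(2)[OF N] nodeD(3)[OF N]) auto

lemma factor:
  assumes "node f T N" "node f T' N'" "T' \<subseteq> T"
  shows "factor N N' T' \<in> garr (fst N) (fst N')"
    "j \<in> T' \<Longrightarrow> snd N' j \<cdot> factor N N' T' = snd N j"
  using theI'[OF factor_ex1[OF assms]] unfolding factor_def by auto

lemma factor_eqI: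
  assumes "node f T N" "node f T' N'" "T' \<subseteq> T" "h \<in> garr (fst N) (fst N')"
    "\<And>j. j \<in> T' \<Longrightarrow> snd N' j \<cdot> h = snd N j"
  shows "factor N N' T' = h"
  unfolding factor_def using factor_ex1[OF assms(1-3)] assms(4,5) by (intro the1_equality) auto

lemma factor_self:
  assumes N: "node f T N" shows "factor N N T = idn top (fst N)"
  using nodeD(1,2)[OF N] by (intro factor_eqI[OF N N]) (auto simp: garr_def)

lemma factor_cmp:
  assumes N: "node f T N" "node f T' N'" "node f T'' N''" and T: "T' \<subseteq> T" "T'' \<subseteq> T'"
  shows "factor N' N'' T'' \<cdot> factor N N' T' = factor N N'' T''"
proof (rule factor_eqI[symmetric, OF N(1,3) order.trans[OF T(2,1)]])
  note h = factor[OF N(1,2) T(1)] and h' = factor[OF N(2,3) T(2)]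
  show "factor N' N'' T'' \<cdot> factor N N' T' \<in> garr (fst N) (fst N'')"
    by (rule garr_cmp[OF h'(1) h(1)])
  fix j assume j: "j \<in> T''"
  have "snd N'' j \<cdot> factor N' N'' T'' \<cdot> factor N N' T' = (snd N'' j \<cdot> factor N' N'' T'') \<cdot> factor N N' T'"
    using garrD[OF h(1)] garrD[OF h'(1)] garrD[OF nodeD(2)[OF N(3) j]] by simp
  also have "\<dots> = snd N j" using h(2) h'(2) j T by auto
  finally show "snd N'' j \<cdot> factor N' N'' T'' \<cdot> factor N N' T' = snd N j" .
qed

text \<open>Comparison maps compose and \<open>gmap\<close> is functorial, so the images under F
  form an inverse system over \<open>T\<close>.\<close>

lemma node_ex:
  assumes inf: "infinite (UNIV :: 'u set)" and small: "small TYPE('u) (UNIV :: 'a set)"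
    and complete: "complete_category TYPE('u) (externalisation C)"
    and f: "\<And>j. j \<in> T \<Longrightarrow> node f (below j) (f j)"
  shows "\<exists>N. node f T N"
proof -
  have "\<exists>L p. is_lim T (\<lambda>j. fobj G (fst (f j))) (\<lambda>j i. gmap (factor (f j) (f i) (below i))) L p"
  proof (rule is_lim_ex[OF inf small complete])
    fix i j k assume i: "i \<in> T" and j: "j \<in> T" and k: "k \<in> T" and ij: "i \<le> j" and jk: "j \<le> k"
    have "gmap (factor (f j) (f i) (below i)) \<cdot> gmap (factor (f k) (f j) (below j)) =
        gmap (factor (f j) (f i) (below i) \<cdot> factor (f k) (f j) (below j))"
      by (rule gmap_cmp[OF factor(1)[OF f[OF j] f[OF i] below_mono[OF ij]]
            factor(1)[OF f[OF k] f[OF j] below_mono[OF jk]], symmetric])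
    also have "\<dots> = gmap (factor (f k) (f i) (below i))"
      by (simp only: factor_cmp[OF f[OF k] f[OF j] f[OF i] below_mono[OF jk] below_mono[OF ij]])
    finally show "gmap (factor (f j) (f i) (below i)) \<cdot> gmap (factor (f k) (f j) (below j)) =
        gmap (factor (f k) (f i) (below i))" .
  next
    fix i j assume i: "i \<in> T" and j: "j \<in> T" and ij: "i \<le> j"
    show "gmap (factor (f j) (f i) (below i)) \<in> garr (fobj G (fst (f j))) (fobj G (fst (f i)))"
      by (rule gmap_garr[OF factor(1)[OF f[OF j] f[OF i] below_mono[OF ij]]])
  qed (simp_all add: gmap_idn nodeD(1)[OF f] factor_self[OF f])
  then show ?thesis by (auto simp: node_def)
qed

text \<open>Completeness only says that some limit exists at each \<open>k\<close>, so the recursion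
  picks one by dependent choice along the well-founded order.\<close>

lemma tower_ex:
  assumes "infinite (UNIV :: 'u set)" "small TYPE('u) (UNIV :: 'a set)"
    and "complete_category TYPE('u) (externalisation C)"
  obtains f where "\<And>k. k \<in> K \<Longrightarrow> node f (below k) (f k)"
proof -
  have "\<exists>f. \<forall>k. k \<in> K \<longrightarrow> node f (below k) (f k)"
  proof (rule dependent_wf_choice[OF wf_K, of "\<lambda>f k N. k \<in> K \<longrightarrow> node f (below k) N"])
    fix f g :: "'a \<Rightarrow> 'o \<times> ('a \<Rightarrow> ('o, 'a, 's) arrow)" and k N
    assume eq: "\<And>j. (j, k) \<in> {(j, k). j \<in> K \<and> k \<in> K \<and> j < k} \<Longrightarrow> f j = g j"
    \<comment> \<open>Only the entries \<open>f j\<close> with \<open>j\<close> in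
      \<open>below k\<close> occur here, also inside \<open>factor\<close>.\<close>
    have "node f (below k) N \<longleftrightarrow> node g (below k) N" if "k \<in> K"
      unfolding node_def using eq that by (intro is_lim_cong) (auto simp: below_def)
    then show "(k \<in> K \<longrightarrow> node f (below k) N) = (k \<in> K \<longrightarrow> node g (below k) N)" by blast
  next
    fix k f
    assume "\<And>j. (j, k) \<in> {(j, k). j \<in> K \<and> k \<in> K \<and> j < k} \<Longrightarrow> j \<in> K \<longrightarrow> node f (below j) (f j)"
    then show "\<exists>N. k \<in> K \<longrightarrow> node f (below k) N"
      using node_ex[OF assms, of "below k" f] by (auto simp: below_def)
  qed
  then show thesis using that by blast
qed

end

section \<open>The fixed point as a retract of the limit\<close>

text \<open>\<open>r\<close> is the algebra structure on the limit over all of \<open>K\<close>: its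
  components are F applied to the comparison maps from \<open>L\<close> to the
  \<open>f j\<close>.\<close>

locale tower = contractive C K G
  for C :: "('o, 'a::complete_heyting_algebra, 's) ecat" and K G +
  fixes f :: "'a \<Rightarrow> 'o \<times> ('a \<Rightarrow> ('o, 'a, 's) arrow)"
    and L :: "'o \<times> ('a \<Rightarrow> ('o, 'a, 's) arrow)"
    and r :: "('o, 'a, 's) arrow"
  assumes f: "k \<in> K \<Longrightarrow> node f (below k) (f k)"
    and L: "node f K L"
    and r: "r \<in> garr (fobj G (fst L)) (fst L)"
      "j \<in> K \<Longrightarrow> snd L j \<cdot> r = gmap (factor L (f j) (below j))"
begin

text \<open>For a node \<open>N\<close> over \<open>T\<close>, \<open>x\<close> is the morphism \<open>N \<rightarrow> F L\<close> at stage \<open>\<Or>T\<close> glued from the family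
  \<open>c\<close>.\<close>

definition retr ::
  "('a \<Rightarrow> ('o, 'a, 's) arrow) \<Rightarrow> 'a set \<Rightarrow> 'o \<times> ('a \<Rightarrow> ('o, 'a, 's) arrow) \<Rightarrow> ('o, 'a, 's) arrow \<Rightarrow> bool"
  where "retr c T N x \<longleftrightarrow> arr x \<and> stg x = Sup T \<and> src x = fst N \<and> tgt x = fobj G (fst L) \<and>
    (\<forall>j\<in>T. x \<restriction> j = lft j (r \<restriction> pred j \<cdot> c j) \<cdot> snd N j \<restriction> j)"

lemma retrD:
  assumes "retr c T N x"
  shows "arr x" "stg x = Sup T" "src x = fst N" "tgt x = fobj G (fst L)"
    "j \<in> T \<Longrightarrow> x \<restriction> j = lft j (r \<restriction> pred j \<cdot> c j) \<cdot> snd N j \<restriction> j"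
  using assms by (auto simp: retr_def)

text \<open>This compatibility makes the gluing possible. At each \<open>l\<close> in
  \<open>below i\<close> both sides are the same lift after a projection, since the comparison map
  followed by a projection of \<open>f i\<close> is a projection of \<open>N\<close>.\<close>

lemma retr_factor:
  assumes N: "node f T N" and T: "T \<subseteq> K" "below i \<subseteq> T" and x: "retr c T N x" and i: "i \<in> T"
    and c: "\<And>j. j \<in> T \<Longrightarrow> retr c (below j) (f j) (c j)"
  shows "x \<restriction> pred i = c i \<cdot> factor N (f i) (below i) \<restriction> pred i"
proof -
  have iK: "i \<in> K" using i T by blast
  let ?h = "factor N (f i) (below i)"
  note h = factor[OF N f[OF iK] T(2)]
  note hD [simp] = garrD[OF h(1)] and xD [simp] = retrD(1-4)[OF x]
    and ciD [simp] = retrD(1-4)[OF c[OF i], unfolded Sup_below]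
  have pi [simp]: "pred i \<le> Sup T" unfolding Sup_below[symmetric] by (rule Sup_subset_mono[OF T(2)])
  show ?thesis
  proof (rule arr_eqI[where S = "below i"])
    fix l assume l: "l \<in> below i"
    then have lT: "l \<in> T" and lp [simp]: "l \<le> pred i"
      using T unfolding Sup_below[symmetric] by (auto intro: Sup_upper)
    have lS [simp]: "l \<le> Sup T" using lT by (rule Sup_upper)
    note clD [simp] = retrD(1-4)[OF c[OF lT], unfolded Sup_below]
    note [simp] = garrD[OF r(1)] garrD[OF nodeD(2)[OF f[OF iK] l]]
    have "x \<restriction> pred i \<restriction> l = x \<restriction> l" by simp
    also have "\<dots> = lft l (r \<restriction> pred l \<cdot> c l) \<cdot> snd N l \<restriction> l" by (rule retrD(5)[OF x lT])
    also have "snd N l \<restriction> l = snd (f i) l \<restriction> l \<cdot> ?h \<restriction> l" by (simp flip: h(2)[OF l])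
    also have "lft l (r \<restriction> pred l \<cdot> c l) \<cdot> snd (f i) l \<restriction> l \<cdot> ?h \<restriction> l =
        (lft l (r \<restriction> pred l \<cdot> c l) \<cdot> snd (f i) l \<restriction> l) \<cdot> ?h \<restriction> l"
      by simp
    also have "\<dots> = c i \<restriction> l \<cdot> ?h \<restriction> l"
      by (simp only: retrD(5)[OF c[OF i] l])
    finally show "x \<restriction> pred i \<restriction> l = (c i \<cdot> ?h \<restriction> pred i) \<restriction> l" by simp
  qed (simp_all add: Sup_below)
qed

lemma retr_ex:
  assumes N: "node f T N" and T: "T \<subseteq> K" "\<And>j k. j \<in> T \<Longrightarrow> k \<in> K \<Longrightarrow> k \<le> j \<Longrightarrow> k \<in> T"
    and c: "\<And>j. j \<in> T \<Longrightarrow> retr c (below j) (f j) (c j)"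
  shows "\<exists>x. retr c T N x"
proof -
  let ?w = "\<lambda>j. lft j (r \<restriction> pred j \<cdot> c j) \<cdot> snd N j \<restriction> j"
  note [simp] = garrD[OF r(1)] retrD(1-4)[OF c, unfolded Sup_below] garrD[OF nodeD(2)[OF N]]
  obtain x where "arr x" "stg x = Sup T" "src x = fst N" "tgt x = fobj G (fst L)"
    "\<And>j. j \<in> T \<Longrightarrow> x \<restriction> j = ?w j"
  proof (rule glue[OF basis_K T(1,2), where X = "fst N" and Y = "fobj G (fst L)" and m = ?w])
    fix i j assume j: "j \<in> T" and i: "i \<in> T" and ij: "i \<le> j"
    show "?w j \<restriction> i = ?w i"
    \<comment> \<open>\<open>retr_factor\<close> is applied to the node \<open>f j\<close>, whose
      indices are strictly below \<open>j\<close>; equality is a separate case.\<close>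
    proof (cases "i = j")
      case True
      show ?thesis unfolding True using j by (intro res_self) simp_all
    next
      case False
      then have ib: "i \<in> below j" using i ij T by (auto simp: below_def)
      have jK: "j \<in> K" and iK: "i \<in> K" using i j T by auto
      let ?h = "factor (f j) (f i) (below i)"
      note h = factor(1)[OF f[OF jK] f[OF iK] below_mono[OF ij]]
      note [simp] = garrD[OF h] predecessor_mono[OF ij]
      have bT: "below j \<subseteq> T" using T(2)[OF j] by (auto simp: below_def)
      have ci: "c j \<restriction> pred i = c i \<cdot> ?h \<restriction> pred i"
        using retr_factor[OF f[OF jK] _ below_mono[OF ij] c[OF j] ib] c bT T(1) by blast
      have gh: "gmap ?h \<restriction> i = lft i (?h \<restriction> pred i)" by (rule res_gmap[OF h])
      \<comment> \<open>By \<open>ci\<close> and functoriality the lift splits off the lift of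
        \<open>?h\<close>, which is the transition map of the inverse system at stage
        \<open>i\<close>.\<close>
      have "?w j \<restriction> i = lft i (r \<restriction> pred i \<cdot> c i) \<cdot> gmap ?h \<restriction> i \<cdot> snd N j \<restriction> i"
        using i j ij by (simp add: ci gh)
      also have "gmap ?h \<restriction> i \<cdot> snd N j \<restriction> i = (gmap ?h \<cdot> snd N j) \<restriction> i"
        using i j ij garrD[OF gmap_garr[OF h]] by simp
      also have "\<dots> = snd N i \<restriction> i" using nodeD(3)[OF N i j ij] by simp
      finally show ?thesis .
    qed
  qed (use nodeD(1)[OF N] nodeD(1)[OF L] in simp_all)
  then show ?thesis by (auto simp: retr_def)
qed

lemma retr_family_ex:
  obtains c where "\<And>k. k \<in> K \<Longrightarrow> retr c (below k) (f k) (c k)"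
proof -
  have "\<exists>c. \<forall>k. k \<in> K \<longrightarrow> retr c (below k) (f k) (c k)"
  proof (rule dependent_wf_choice[OF wf_K, of "\<lambda>c k x. k \<in> K \<longrightarrow> retr c (below k) (f k) x"])
    fix c c' :: "'a \<Rightarrow> ('o, 'a, 's) arrow" and k x
    assume "\<And>j. (j, k) \<in> {(j, k). j \<in> K \<and> k \<in> K \<and> j < k} \<Longrightarrow> c j = c' j"
    then show "(k \<in> K \<longrightarrow> retr c (below k) (f k) x) = (k \<in> K \<longrightarrow> retr c' (below k) (f k) x)"
      by (auto simp: retr_def below_def)
  next
    fix k c
    assume "\<And>j. (j, k) \<in> {(j, k). j \<in> K \<and> k \<in> K \<and> j < k} \<Longrightarrow> j \<in> K \<longrightarrow> retr c (below j) (f j) (c j)"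
    then show "\<exists>x. k \<in> K \<longrightarrow> retr c (below k) (f k) x"
      using retr_ex[OF f, of k c] by (fastforce simp: below_def)
  qed
  then show thesis using that by blast
qed

text \<open>Both equations are checked on the cover \<open>K\<close> of \<open>top\<close>: the
  first by comparing \<open>L\<close> with each \<open>f j\<close>, the second by well-founded
  induction through the family \<open>c\<close>.\<close>

lemma section_retraction_ex:
  obtains x where "x \<in> garr (fst L) (fobj G (fst L))" "x \<cdot> r = gmap (r \<cdot> x)" "gmap (r \<cdot> x) \<cdot> x = x"
proof -
  obtain c where c: "\<And>k. k \<in> K \<Longrightarrow> retr c (below k) (f k) (c k)" by (rule retr_family_ex) blast
  obtain x where x: "retr c K L x" using retr_ex[OF L _ _ c] by blast
  have gx: "x \<in> garr (fst L) (fobj G (fst L))"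
    using retrD(1-4)[OF x] by (simp add: garr_def Sup_K)
  have grx: "r \<cdot> x \<in> garr (fst L) (fst L)" by (rule garr_cmp[OF r(1) gx])
  note gg = gmap_garr[OF grx]
  note [simp] = garrD[OF r(1)] garrD[OF gx] garrD[OF gg]
  have xr: "x \<cdot> r = gmap (r \<cdot> x)"
  proof (rule arr_eqI[where S = K])
    fix j assume j: "j \<in> K"
    let ?h = "factor L (f j) (below j)"
    have bK: "below j \<subseteq> K" by (auto simp: below_def)
    note h = factor(1)[OF L f[OF j] bK]
    note [simp] = garrD[OF h] retrD(1-4)[OF c[OF j], unfolded Sup_below] garrD[OF nodeD(2)[OF L j]]
    have "(x \<cdot> r) \<restriction> j = (lft j (r \<restriction> pred j \<cdot> c j) \<cdot> snd L j \<restriction> j) \<cdot> r \<restriction> j"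
      using retrD(5)[OF x j] by simp
    also have "\<dots> = lft j (r \<restriction> pred j \<cdot> c j) \<cdot> (snd L j \<cdot> r) \<restriction> j" by simp
    also have "(snd L j \<cdot> r) \<restriction> j = lft j (?h \<restriction> pred j)" using r(2)[OF j] res_gmap[OF h] by simp
    also have "lft j (r \<restriction> pred j \<cdot> c j) \<cdot> lft j (?h \<restriction> pred j) =
        lft j (r \<restriction> pred j \<cdot> c j \<cdot> ?h \<restriction> pred j)" by simp
    \<comment> \<open>The glued \<open>x\<close> itself reappears, because \<open>L\<close> is a
      node over all of \<open>K\<close>.\<close>
    also have "c j \<cdot> ?h \<restriction> pred j = x \<restriction> pred j"
      using retr_factor[OF L order.refl bK x j c] by simp
    also have "lft j (r \<restriction> pred j \<cdot> x \<restriction> pred j) = gmap (r \<cdot> x) \<restriction> j"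
      using res_gmap[OF grx, of j] by simp
    finally show "(x \<cdot> r) \<restriction> j = gmap (r \<cdot> x) \<restriction> j" .
  qed (simp_all add: Sup_K)
  \<comment> \<open>Stated for an arbitrary node, so that it serves both the induction step with
    \<open>below k\<close> and the final case \<open>K\<close>.\<close>
  have step: "gmap (r \<cdot> x) \<restriction> Sup T \<cdot> y = y"
    if T: "T \<subseteq> K" and N: "node f T N" and y: "retr c T N y"
      and IH: "\<And>j. j \<in> T \<Longrightarrow> gmap (r \<cdot> x) \<restriction> pred j \<cdot> c j = c j" for T N y
  proof (rule arr_eqI[where S = T])
    note [simp] = retrD(1-4)[OF y]
    fix i assume i: "i \<in> T"
    then have iK: "i \<in> K" using T by blast
    note [simp] = retrD(1-4)[OF c[OF iK], unfolded Sup_below] garrD[OF nodeD(2)[OF N i]] Sup_upper[OF i]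
    \<comment> \<open>Regrouping exposes \<open>x\<close> after \<open>r\<close>, which
      \<open>xr\<close> turns into \<open>gmap (r \<cdot> x)\<close>; the induction hypothesis
      absorbs it into \<open>c i\<close>.\<close>
    have "(r \<cdot> x) \<restriction> pred i \<cdot> r \<restriction> pred i \<cdot> c i = r \<restriction> pred i \<cdot> (x \<cdot> r) \<restriction> pred i \<cdot> c i" by simp
    also have "\<dots> = r \<restriction> pred i \<cdot> c i" by (simp only: xr IH[OF i])
    finally have *: "(r \<cdot> x) \<restriction> pred i \<cdot> r \<restriction> pred i \<cdot> c i = r \<restriction> pred i \<cdot> c i" .
    have "(gmap (r \<cdot> x) \<restriction> Sup T \<cdot> y) \<restriction> i =
        lft i ((r \<cdot> x) \<restriction> pred i) \<cdot> lft i (r \<restriction> pred i \<cdot> c i) \<cdot> snd N i \<restriction> i"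
      using retrD(5)[OF y i] res_gmap[OF grx, of i] by simp
    also have "\<dots> = lft i ((r \<cdot> x) \<restriction> pred i \<cdot> r \<restriction> pred i \<cdot> c i) \<cdot> snd N i \<restriction> i" by simp
    also have "\<dots> = y \<restriction> i" unfolding * using retrD(5)[OF y i] by simp
    finally show "(gmap (r \<cdot> x) \<restriction> Sup T \<cdot> y) \<restriction> i = y \<restriction> i" .
  qed (use retrD(1-4)[OF y] in simp_all)
  have "gmap (r \<cdot> x) \<restriction> pred k \<cdot> c k = c k" if "k \<in> K" for k
    using wf_K that
  proof (induction k rule: wf_induct_rule)
    case (less k)
    then show ?case
      using step[OF _ f[OF less.prems] c[OF less.prems]] unfolding Sup_below
      by (auto simp: below_def)
  qed
  then have "gmap (r \<cdot> x) \<restriction> Sup K \<cdot> x = x" by (rule step[OF order.refl L x])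
  then show thesis using that[OF gx xr] res_self[OF garrD(1,2)[OF gg]] by (simp add: Sup_K)
qed

end

section \<open>Construction of the fixed point\<close>

context contractive
begin

text \<open>F applied to the comparison maps from \<open>L\<close> to the \<open>f j\<close> is a
  cone over the diagram of \<open>L\<close>, by functoriality.\<close>

lemma algebra_ex:
  assumes f: "\<And>k. k \<in> K \<Longrightarrow> node f (below k) (f k)" and L: "node f K L"
  obtains r where "r \<in> garr (fobj G (fst L)) (fst L)"
    "\<And>j. j \<in> K \<Longrightarrow> snd L j \<cdot> r = gmap (factor L (f j) (below j))"
proof -
  have bK: "below j \<subseteq> K" for j by (auto simp: below_def)
  have "\<exists>!r. r \<in> garr (fobj G (fst L)) (fst L) \<and>
      (\<forall>j\<in>K. snd L j \<cdot> r = gmap (factor L (f j) (below j)))"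
  proof (rule nodeD(4)[OF L])
    show "fobj G (fst L) \<in> eobjs C" using nodeD(1)[OF L] by simp
    show "gmap (factor L (f j) (below j)) \<in> garr (fobj G (fst L)) (fobj G (fst (f j)))" if "j \<in> K" for j
      by (rule gmap_garr, rule factor(1)[OF L f[OF that] bK])
    show "gmap (factor (f j) (f i) (below i)) \<cdot> gmap (factor L (f j) (below j)) =
        gmap (factor L (f i) (below i))" if "i \<in> K" "j \<in> K" "i \<le> j" for i j
      using gmap_cmp[OF factor(1)[OF f f below_mono] factor(1)[OF L f bK]]
        factor_cmp[OF L f f bK below_mono] that by simp
  qed
  then show thesis using that by blast
qed

lemma fixed_point:
  assumes inf: "infinite (UNIV :: 'u set)" and small: "small TYPE('u) (UNIV :: 'a set)"
    and complete: "complete_category TYPE('u) (externalisation C)"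
  shows "\<exists>Z\<in>eobjs C. isomorphic (externalisation C) (fobj G Z) Z"
proof -
  obtain f where f: "\<And>k. k \<in> K \<Longrightarrow> node f (below k) (f k)"
    by (rule tower_ex[OF assms]) blast
  obtain N where N: "node f K N" using node_ex[OF assms f] by blast
  obtain r where r: "r \<in> garr (fobj G (fst N)) (fst N)"
    "\<And>j. j \<in> K \<Longrightarrow> snd N j \<cdot> r = gmap (factor N (f j) (below j))"
    using algebra_ex[OF f N] by blast
  interpret tower C K G f N r
    by unfold_locales (fact f, fact N, fact r(1), fact r(2))
  obtain c where c: "c \<in> garr (fst N) (fobj G (fst N))" "c \<cdot> r = gmap (r \<cdot> c)"
    "gmap (r \<cdot> c) \<cdot> c = c"
    by (rule section_retraction_ex)
  let ?e = "r \<cdot> c"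
  note e = garr_cmp[OF r(1) c(1)]
  note [simp] = garrD[OF r(1)] garrD[OF c(1)]
  have "?e \<cdot> ?e = r \<cdot> (c \<cdot> r) \<cdot> c" by simp
  also have "\<dots> = ?e" by (simp only: c(2,3))
  finally have ee: "?e \<cdot> ?e = ?e" .
  obtain Z q i where Z: "Z \<in> eobjs C" "q \<in> garr (fst N) Z" "i \<in> garr Z (fst N)"
    "i \<cdot> q = ?e" "q \<cdot> i = idn top Z"
    using idempotent_splits[OF inf category_globals complete_globals[OF complete], of "fst N" ?e]
      nodeD(1)[OF N] e ee by auto
  note gi = gmap_garr[OF Z(3)] and gq = gmap_garr[OF Z(2)]
  note [simp] = garrD[OF Z(2)] garrD[OF Z(3)] garrD[OF gi] garrD[OF gq]
  \<comment> \<open>\<open>?e\<close> is \<open>r\<close> after \<open>c\<close> and splits through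
    \<open>Z\<close>; \<open>c\<close> after \<open>r\<close> is \<open>gmap ?e\<close> and splits
    through \<open>fobj G Z\<close>. These are the induced maps between the two splittings.\<close>
  define u where "u = gmap q \<cdot> c \<cdot> i"
  define v where "v = q \<cdot> r \<cdot> gmap i"
  have uv: "u \<in> garr Z (fobj G Z)" "v \<in> garr (fobj G Z) Z"
    unfolding u_def v_def using r(1) c(1) Z gi gq by (blast intro: garr_cmp)+
  have giq: "gmap i \<cdot> gmap q = gmap ?e" using gmap_cmp[OF Z(3,2)] Z(4) by simp
  have gqi: "gmap q \<cdot> gmap i = idn top (fobj G Z)"
    using gmap_cmp[OF Z(2,3)] Z(5) gmap_idn[OF Z(1)] by simp
  \<comment> \<open>The inner \<open>gmap i\<close> after \<open>gmap q\<close> is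
    \<open>gmap ?e\<close>, which fixes \<open>c\<close>.\<close>
  have "v \<cdot> u = q \<cdot> r \<cdot> ((gmap i \<cdot> gmap q) \<cdot> c) \<cdot> i" by (simp add: u_def v_def)
  also have "\<dots> = q \<cdot> (r \<cdot> c) \<cdot> i" by (simp add: giq c(3))
  also have "\<dots> = (q \<cdot> i) \<cdot> (q \<cdot> i)" by (simp flip: Z(4))
  finally have vu: "v \<cdot> u = idn top Z" using Z(1,5) by simp
  have "u \<cdot> v = gmap q \<cdot> (c \<cdot> (i \<cdot> q) \<cdot> r) \<cdot> gmap i" by (simp add: u_def v_def)
  also have "c \<cdot> (i \<cdot> q) \<cdot> r = (c \<cdot> r) \<cdot> (c \<cdot> r)" by (simp add: Z(4))
  \<comment> \<open>Each \<open>c\<close> after \<open>r\<close> is \<open>gmap ?e\<close>;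
    expanding it through the splitting leaves three copies of \<open>gmap q\<close> after
    \<open>gmap i\<close>, all identities.\<close>
  also have "\<dots> = (gmap i \<cdot> gmap q) \<cdot> (gmap i \<cdot> gmap q)" by (simp only: c(2) giq)
  also have "gmap q \<cdot> \<dots> \<cdot> gmap i = (gmap q \<cdot> gmap i) \<cdot> (gmap q \<cdot> gmap i) \<cdot> (gmap q \<cdot> gmap i)" by simp
  finally have "u \<cdot> v = idn top (fobj G Z)" using Z(1) by (simp add: gqi)
  with uv vu have "isomorphic globals (fobj G Z) Z" unfolding isomorphic_def by auto
  then show ?thesis
    using isomorphic_globals[OF _ obj_G[OF Z(1)] Z(1)] Z(1) by blast
qed

end

text \<open>An infinite \<open>'u\<close> makes the finite index category of an idempotent small;
  smallness of \<open>'a\<close> provides the limits of the tower.\<close>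

theorem theorem8p6:
  fixes K :: "'a::complete_heyting_algebra set"
    and C :: "('o, 'a, 's) ecat"
  assumes "infinite (UNIV :: 'u set)"
    and "small TYPE('u) (UNIV :: 'a set)"
    and "well_founded_basis K"
    and "enriched_category C"
    and "complete_category TYPE('u) (externalisation C)"
  shows "contractively_complete K C"
  unfolding contractively_complete_def
proof (intro allI impI, elim conjE)
  fix F assume "locally_contractive K C C F"
  then obtain G where G: "enriched_functor (later_ecat K C) C G"
    and F: "efunctor_eq C F (efunctor_comp G (next_efunctor K C))"
    unfolding locally_contractive_def by blast
  interpret contractive C K G
    by unfold_locales (fact assms(4), fact assms(3), fact G)
  \<comment> \<open>\<open>next\<close> is the identity on objects.\<close>
  have "fobj F X = fobj G X" if "X \<in> eobjs C" for X
    using F that by (simp add: efunctor_eq_def efunctor_comp_def next_efunctor_def)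
  then show "\<exists>X\<in>eobjs C. isomorphic (externalisation C) (fobj F X) X"
    using fixed_point[OF assms(1,2,5)] by simp
qed

end
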